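(* For any Brjuno number $\theta$ and any integer $p\geq 1$, there exists $\lambda\in\mathbb{C}\setminus\{0\}$ such that $E_\lambda(z)=\lambda z^2 e^z$ has a $p$-cycle of Siegel disks with rotation number $\theta$.
   Context: Brjuno number: an irrational number $\theta\in(0,1)$ with continued fraction expansion $[0;a_1,a_2,\dots]$ such that $\sum_{n\ge1}\frac{\log q_{n+1}}{q_n}<+\infty$, where $q_n$ is the denominator of the reduced fraction $\frac{p_n}{q_n}=[0;a_1,\dots,a_n]$. A $p$-cycle of Siegel disks of $f$ with rotation number $\theta$ is a cycle of simply connected Fatou components of exact period $p$ on each of which $f^{\circ p}$ is conformally conjugate to the rotation $\zeta\mapsto e^{2\pi i\theta}\zeta$ of the unit disk. *)

theory Defs
  imports "HOL-Complex_Analysis.Complex_Analysis"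
begin

text \<open>Regular continued fraction of \<open>\<theta> \<in> (0,1)\<close>, obtained by iterating the Gauss map
  \<open>x \<mapsto> frac (1 / x)\<close>; \<open>partial_quotient \<theta> n\<close> is \<open>a\<^sub>n\<close> and is only meaningful for \<open>n \<ge> 1\<close>.\<close>

definition gauss_map :: "real \<Rightarrow> real" where
  "gauss_map x = frac (1 / x)"

definition partial_quotient :: "real \<Rightarrow> nat \<Rightarrow> int" where
  "partial_quotient \<theta> n = \<lfloor>1 / (gauss_map ^^ (n - 1)) \<theta>\<rfloor>"

text \<open>\<open>finite_cf [a\<^sub>1, \<dots>, a\<^sub>n]\<close> is the value of \<open>[0; a\<^sub>1, \<dots>, a\<^sub>n]\<close>.\<close>

fun finite_cf :: "int list \<Rightarrow> rat" where
  "finite_cf [] = 0"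
| "finite_cf (a # as) = 1 / (of_int a + finite_cf as)"

definition convergent_denom :: "real \<Rightarrow> nat \<Rightarrow> int" where
  "convergent_denom \<theta> n =
     snd (quotient_of (finite_cf (map (partial_quotient \<theta>) [1..<Suc n])))"

text \<open>The terms of the series are nonnegative, so \<open>summable\<close> says exactly that the sum is finite.
  The index is shifted by one because the series starts at \<open>n = 1\<close>.\<close>

definition brjuno :: "real \<Rightarrow> bool" where
  "brjuno \<theta> \<longleftrightarrow> 0 < \<theta> \<and> \<theta> < 1 \<and> \<theta> \<notin> \<rat> \<and>
     summable (\<lambda>n. ln (real_of_int (convergent_denom \<theta> (n + 2))) /
                   real_of_int (convergent_denom \<theta> (n + 1)))"

text \<open>Normality in the sense of the Riemann sphere, for holomorphic functions on a domain:
  the limit of a subsequence is either holomorphic or identically \<open>\<infinity>\<close>.  This form of the definition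
  is only appropriate for connected \<open>D\<close>, and is only used for such \<open>D\<close>.\<close>

definition normal_family :: "(complex \<Rightarrow> complex) set \<Rightarrow> complex set \<Rightarrow> bool" where
  "normal_family \<F> D \<longleftrightarrow>
     (\<forall>s :: nat \<Rightarrow> complex \<Rightarrow> complex. range s \<subseteq> \<F> \<longrightarrow>
       (\<exists>r :: nat \<Rightarrow> nat. strict_mono r \<and>
         ((\<exists>g. g holomorphic_on D \<and>
              (\<forall>K. compact K \<and> K \<subseteq> D \<longrightarrow> uniform_limit K (s \<circ> r) g sequentially)) \<or>
          (\<forall>K. compact K \<and> K \<subseteq> D \<longrightarrow>
              (\<forall>B. \<forall>\<^sub>F n in sequentially. \<forall>z\<in>K. B < norm (s (r n) z))))))"

definition fatou_set :: "(complex \<Rightarrow> complex) \<Rightarrow> complex set" where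
  "fatou_set f =
     {z. \<exists>D. open D \<and> connected D \<and> z \<in> D \<and> normal_family (range (\<lambda>n. f ^^ n)) D}"

definition conformal_iso :: "(complex \<Rightarrow> complex) \<Rightarrow> complex set \<Rightarrow> complex set \<Rightarrow> bool" where
  "conformal_iso \<phi> U V \<longleftrightarrow>
     bij_betw \<phi> U V \<and> \<phi> holomorphic_on U \<and> inv_into U \<phi> holomorphic_on V"

definition conj_to_rotation :: "(complex \<Rightarrow> complex) \<Rightarrow> complex set \<Rightarrow> real \<Rightarrow> bool" where
  "conj_to_rotation h U \<theta> \<longleftrightarrow>
     h ` U \<subseteq> U \<and>
     (\<exists>\<phi>. conformal_iso \<phi> U (ball 0 1) \<and>
          (\<forall>z\<in>U. \<phi> (h z) = exp (2 * complex_of_real pi * \<i> * complex_of_real \<theta>) * \<phi> z))"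

text \<open>The components \<open>U 0, \<dots>, U (p - 1)\<close> are pairwise distinct, so the period \<open>p\<close> is exact.
  A cycle of Fatou components of an entire function is given by inclusions
  \<open>f ` U i \<subseteq> U (i + 1)\<close>; here equality follows, as \<open>f ^^ p\<close> is bijective on each component.\<close>

definition siegel_cycle ::
    "(complex \<Rightarrow> complex) \<Rightarrow> nat \<Rightarrow> real \<Rightarrow> (nat \<Rightarrow> complex set) \<Rightarrow> bool" where
  "siegel_cycle f p \<theta> U \<longleftrightarrow>
     inj_on U {..<p} \<and>
     (\<forall>i<p. U i \<in> components (fatou_set f) \<and> simply_connected (U i) \<and>
            f ` U i \<subseteq> U (Suc i mod p) \<and> conj_to_rotation (f ^^ p) (U i) \<theta>)"

definition E :: "complex \<Rightarrow> complex \<Rightarrow> complex" where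
  "E lam z = lam * z\<^sup>2 * exp z"

end

theory Submission imports Defs "HOL-Real_Asymp.Real_Asymp" begin

text \<open>A point \<open>a\<close> of exact period \<open>p\<close> and multiplier \<open>\<rho> = exp (2 * pi * \<i> * \<theta>)\<close> is found with \<open>lam\<close> large,
  along an orbit that starts near the critical point \<open>-2\<close>, visits a huge point, and comes back to \<open>-2\<close>
  through points close to \<open>0\<close>.  The multiplier of the cycle is the product of the \<open>2 + z\<^sub>i\<close>, so in
  logarithmic coordinates periodicity and the multiplier condition become a self-map of a compact
  convex subset of \<open>\<complex>\<^sup>2\<close>, to which Brouwer's theorem applies.

  By Brjuno's theorem the iterate of order \<open>p\<close> is linearizable at \<open>a\<close>: the small divisors accumulated in
  the formal linearization are controlled by a superadditive function \<open>K\<close> of linear growth, as in Davie's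
  version of Brjuno's counting argument, and the remaining recursion is majorized by a geometric
  series.  Hence the iterates are bounded near \<open>a\<close>.

  A Fatou component containing a point near which the iterates are bounded consists of such points,
  so the maximum principle makes it simply connected.  It is not the whole plane because \<open>0\<close> is
  attracting, and the Riemann map conjugates the return map to a self-map of the disk that fixes
  \<open>0\<close> with derivative of modulus \<open>1\<close>, a rotation by Schwarz's lemma.\<close>

section \<open>Continued fractions\<close>

text \<open>Shifted indices: \<open>cf_num a (n + 1) / cf_den a (n + 1)\<close> is the convergent
  \<open>[0; a\<^sub>1, \<dots>, a\<^sub>n]\<close>, and index \<open>0\<close> carries the usual \<open>p\<^sub>-\<^sub>1 = 1\<close>, \<open>q\<^sub>-\<^sub>1 = 0\<close>.\<close>

fun cf_num :: "(nat \<Rightarrow> int) \<Rightarrow> nat \<Rightarrow> int" where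
  "cf_num a 0 = 1"
| "cf_num a (Suc 0) = 0"
| "cf_num a (Suc (Suc n)) = a (Suc n) * cf_num a (Suc n) + cf_num a n"

fun cf_den :: "(nat \<Rightarrow> int) \<Rightarrow> nat \<Rightarrow> int" where
  "cf_den a 0 = 0"
| "cf_den a (Suc 0) = 1"
| "cf_den a (Suc (Suc n)) = a (Suc n) * cf_den a (Suc n) + cf_den a n"

lemma cf_det: "cf_num a (Suc n) * cf_den a n - cf_num a n * cf_den a (Suc n) = - ((-1) ^ n)"
proof (induction n)
  case (Suc n)
  then show ?case by (simp add: algebra_simps)
qed simp

lemma cf_den_ge:
  assumes "\<And>k. a (Suc k) \<ge> 1"
  shows "cf_den a (Suc n) \<ge> 1 \<and> cf_den a n \<ge> 0 \<and> cf_den a (Suc (Suc n)) \<ge> int n + 1"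
proof (induction n)
  case 0
  then show ?case using assms[of 0] by simp
next
  case (Suc n)
  let ?q = "cf_den a (Suc (Suc n))"
  have "1 * ?q \<le> a (Suc (Suc n)) * ?q"
    by (rule mult_right_mono) (use Suc assms[of "Suc n"] in auto)
  then show ?case using Suc unfolding cf_den.simps(3)[of a "Suc n"] by linarith
qed

text \<open>Absorbing the last partial quotient into the tail replaces \<open>x\<close> by
  \<open>1 / (a (Suc n) + x)\<close> one level lower, and clearing the denominator \<open>c\<close>
  reproduces the recursions. The tail \<open>0\<close> gives the convergents; the tail given by the
  Gauss iterate gives \<theta> itself.\<close>

lemma cf_tail_value:
  assumes "\<And>k. a (Suc k) \<ge> 1" "x \<ge> (0::real)"
  shows "foldr (\<lambda>k y. 1 / (of_int (a k) + y)) [1..<Suc n] x =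
    (of_int (cf_num a (Suc n)) + x * of_int (cf_num a n)) /
    (of_int (cf_den a (Suc n)) + x * of_int (cf_den a n))"
  using assms(2)
proof (induction n arbitrary: x)
  case (Suc n)
  define c where "c = of_int (a (Suc n)) + x"
  have c: "c > 0" using assms(1)[of n] Suc.prems by (simp add: c_def)
  have "foldr (\<lambda>k y. 1 / (of_int (a k) + y)) [1..<Suc (Suc n)] x
      = foldr (\<lambda>k y. 1 / (of_int (a k) + y)) [1..<Suc n] (1 / c)"
    by (simp add: c_def)
  also have "\<dots> = (of_int (cf_num a (Suc n)) + (1 / c) * of_int (cf_num a n)) /
    (of_int (cf_den a (Suc n)) + (1 / c) * of_int (cf_den a n))"
    using c by (intro Suc.IH) auto
  also have "\<dots> = (c * (of_int (cf_num a (Suc n)) + (1 / c) * of_int (cf_num a n))) /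
    (c * (of_int (cf_den a (Suc n)) + (1 / c) * of_int (cf_den a n)))"
    using c by simp
  also have "\<dots> = (c * of_int (cf_num a (Suc n)) + of_int (cf_num a n)) /
    (c * of_int (cf_den a (Suc n)) + of_int (cf_den a n))"
    using c by (simp add: distrib_left)
  finally show ?case by (simp add: c_def algebra_simps)
qed simp

lemma of_rat_finite_cf:
  "of_rat (finite_cf (map a ks)) = foldr (\<lambda>k y. 1 / (of_int (a k) + y)) ks (0::real)"
  by (induction ks) (simp_all add: of_rat_divide of_rat_add)

lemma gauss_orbit:
  assumes "0 < \<theta>" "\<theta> < 1" "\<theta> \<notin> \<rat>"
  shows "0 < (gauss_map ^^ n) \<theta> \<and> (gauss_map ^^ n) \<theta> < 1 \<and> (gauss_map ^^ n) \<theta> \<notin> \<rat>"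
proof (induction n)
  case (Suc n)
  let ?x = "(gauss_map ^^ n) \<theta>"
  have irr: "1 / ?x \<notin> \<rat>"
  proof
    assume "1 / ?x \<in> \<rat>"
    then have "1 / (1 / ?x) \<in> \<rat>" by (rule Rats_divide[OF Rats_1])
    moreover have "1 / (1 / ?x) = ?x" by simp
    ultimately show False using Suc by metis
  qed
  have "frac (1 / ?x) \<notin> \<rat>"
  proof
    assume "frac (1 / ?x) \<in> \<rat>"
    then have "frac (1 / ?x) + of_int \<lfloor>1 / ?x\<rfloor> \<in> \<rat>" by (intro Rats_add) auto
    then show False using irr by (simp add: frac_def)
  qed
  moreover from this have "frac (1 / ?x) \<noteq> 0" by (metis Rats_0)
  ultimately show ?case
    using frac_ge_0[of "1 / ?x"] frac_lt_1[of "1 / ?x"]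
    unfolding funpow.simps o_apply gauss_map_def[of "(gauss_map ^^ n) \<theta>"] by linarith
qed (use assms in simp)

lemma partial_quotient_ge_1:
  assumes "0 < \<theta>" "\<theta> < 1" "\<theta> \<notin> \<rat>"
  shows "partial_quotient \<theta> (Suc k) \<ge> 1"
  using gauss_orbit[OF assms, of k] by (simp add: partial_quotient_def le_floor_iff)

lemma cf_complete_quotient:
  assumes "0 < \<theta>" "\<theta> < 1" "\<theta> \<notin> \<rat>"
  shows "\<theta> = foldr (\<lambda>k y. 1 / (of_int (partial_quotient \<theta> k) + y)) [1..<Suc n]
               ((gauss_map ^^ n) \<theta>)"
proof (induction n)
  case (Suc n)
  have "1 / (of_int (partial_quotient \<theta> (Suc n)) + (gauss_map ^^ Suc n) \<theta>) = (gauss_map ^^ n) \<theta>"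
    by (simp add: partial_quotient_def gauss_map_def frac_def)
  with Suc show ?case by simp
qed simp

text \<open>The determinant identity makes numerator and denominator coprime, and the denominator is
  positive, so the pair already is the normal form that \<open>quotient_of\<close> returns.\<close>

lemma convergent_denom_eq:
  assumes "0 < \<theta>" "\<theta> < 1" "\<theta> \<notin> \<rat>"
  shows "quotient_of (finite_cf (map (partial_quotient \<theta>) [1..<Suc n])) =
    (cf_num (partial_quotient \<theta>) (Suc n), cf_den (partial_quotient \<theta>) (Suc n))"
proof -
  let ?a = "partial_quotient \<theta>"
  let ?p = "cf_num ?a (Suc n)" and ?q = "cf_den ?a (Suc n)"
  note a = partial_quotient_ge_1[OF assms]
  have q: "?q \<ge> 1" using cf_den_ge[of ?a n] a by blast
  have "(of_rat (finite_cf (map ?a [1..<Suc n])) :: real) = of_int ?p / of_int ?q"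
    using cf_tail_value[of ?a 0 n] a unfolding of_rat_finite_cf by simp
  also have "\<dots> = of_rat (Fract ?p ?q)"
    using q by (simp add: of_rat_rat)
  finally have eq: "finite_cf (map ?a [1..<Suc n]) = Fract ?p ?q"
    by (simp only: of_rat_eq_iff)
  have "coprime ?p ?q"
  proof (rule coprimeI)
    fix c assume "c dvd ?p" "c dvd ?q"
    then have "c dvd (?p * cf_den ?a n - cf_num ?a n * ?q)" by auto
    then have "c dvd - ((-1) ^ n)" by (simp only: cf_det)
    then show "is_unit c" by (cases "even n") auto
  qed
  then show ?thesis unfolding eq quotient_of_Fract using q by (simp add: normalize_stable)
qed

text \<open>With \<theta> written as the Moebius image of its Gauss iterate \<open>x\<close>, the
  determinant identity reduces the error to \<open>x / (q * (q + x * q'))\<close> up to sign, and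
  \<open>0 < x < 1\<close>.\<close>

lemma convergent_approx:
  fixes \<theta> :: real and n :: nat
  assumes "0 < \<theta>" "\<theta> < 1" "\<theta> \<notin> \<rat>"
  defines "q \<equiv> convergent_denom \<theta> n"
  obtains p where "coprime p q" "q > 0" "\<bar>\<theta> - of_int p / of_int q\<bar> \<le> 1 / (of_int q)\<^sup>2"
proof -
  let ?a = "partial_quotient \<theta>"
  note a = partial_quotient_ge_1[OF assms(1-3)]
  define x where "x = (gauss_map ^^ n) \<theta>"
  have x: "0 < x" "x < 1" using gauss_orbit[OF assms(1-3)] by (auto simp: x_def)
  define p where "p = cf_num ?a (Suc n)"
  define p' q' where "p' = real_of_int (cf_num ?a n)" and "q' = real_of_int (cf_den ?a n)"
  have q: "q = cf_den ?a (Suc n)" unfolding q_def convergent_denom_def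
    by (simp only: convergent_denom_eq[OF assms(1-3)] snd_conv)
  have q1: "q \<ge> 1" "q' \<ge> 0" using cf_den_ge[of ?a n] a by (auto simp: q q'_def)
  have "coprime p q" using quotient_of_coprime[OF convergent_denom_eq[OF assms(1-3), of n]]
    by (simp add: p_def q)
  have "real_of_int (p * cf_den ?a n - cf_num ?a n * q) = real_of_int (- ((-1)^n))"
    unfolding p_def q cf_det ..
  then have det: "of_int p * q' - p' * of_int q = - ((-1)^n)"
    by (simp add: p'_def q'_def)
  have \<theta>: "\<theta> = (of_int p + x * p') / (of_int q + x * q')"
    using cf_tail_value[of ?a x n] a x cf_complete_quotient[OF assms(1-3), of n, folded x_def]
    unfolding p_def q p'_def q'_def by simp
  have pos: "of_int q + x * q' \<ge> of_int q" "real_of_int q > 0" using x q1 by auto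
  then have pos': "of_int q + x * q' > 0" by linarith
  have "\<theta> - of_int p / of_int q = x * (p' * of_int q - of_int p * q') / ((of_int q + x * q') * of_int q)"
    unfolding \<theta> using pos pos' by (simp add: divide_simps algebra_simps)
  also have "p' * of_int q - of_int p * q' = (-1)^n" using det by linarith
  finally have "\<bar>\<theta> - of_int p / of_int q\<bar> = x / ((of_int q + x * q') * of_int q)"
    using x pos pos' by (simp add: abs_mult)
  also have "\<dots> \<le> 1 / (of_int q * of_int q)"
    using x pos pos' by (intro frac_le mult_right_mono mult_pos_pos) auto
  finally show thesis using that[of p] \<open>coprime p q\<close> q1 by (simp add: power2_eq_square)
qed

lemma convergent_denom_ge:
  assumes "0 < \<theta>" "\<theta> < 1" "\<theta> \<notin> \<rat>"
  shows "convergent_denom \<theta> (Suc n) \<ge> int n + 1"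
proof -
  have "convergent_denom \<theta> (Suc n) = cf_den (partial_quotient \<theta>) (Suc (Suc n))"
    unfolding convergent_denom_def by (simp only: convergent_denom_eq[OF assms] snd_conv)
  then show ?thesis using cf_den_ge[of "partial_quotient \<theta>" n] partial_quotient_ge_1[OF assms] by simp
qed

text \<open>By coprimality \<open>m * p / q\<close> is at distance at least \<open>1 / q\<close>
  from every integer. Replacing \<open>p / q\<close> by \<theta> moves it by at most
  \<open>m / q^2\<close>, which is at most half of that distance.\<close>

lemma rational_approx_distance:
  fixes \<theta> :: real and p q m r :: int
  assumes pq: "coprime p q" "q > 0" and approx: "\<bar>\<theta> - of_int p / of_int q\<bar> \<le> 1 / (of_int q)\<^sup>2"
    and m: "0 < m" "2 * m \<le> q" "m < q"
  shows "1 / (2 * of_int q) \<le> \<bar>of_int m * \<theta> - of_int r\<bar>"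
proof -
  have "m * p \<noteq> r * q"
  proof
    assume "m * p = r * q"
    then have "q dvd m * p" by simp
    then have "q dvd m" using pq by (simp add: coprime_commute coprime_dvd_mult_left_iff)
    then show False using m zdvd_imp_le by force
  qed
  then have "1 \<le> \<bar>m * p - r * q\<bar>" by linarith
  then have "1 \<le> real_of_int \<bar>m * p - r * q\<bar>" by linarith
  then have one: "1 \<le> \<bar>real_of_int m * of_int p - of_int r * of_int q\<bar>" by simp
  define Q where "Q = real_of_int q"
  have Q: "Q > 0" using pq by (simp add: Q_def)
  have eq: "real_of_int m * \<theta> - of_int r =
      (of_int m * of_int p - of_int r * Q) / Q + of_int m * (\<theta> - of_int p / Q)"
    using Q by (simp add: field_simps)
  have "\<bar>of_int m * (\<theta> - of_int p / Q)\<bar> \<le> of_int m * (1 / Q\<^sup>2)"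
    unfolding abs_mult using approx m by (intro mult_mono) (auto simp: Q_def)
  also have "\<dots> \<le> (Q / 2) * (1 / Q\<^sup>2)"
    using m Q by (intro mult_right_mono) (auto simp: Q_def)
  also have "\<dots> = 1 / (2 * Q)" using Q by (simp add: power2_eq_square)
  finally have 1: "\<bar>of_int m * (\<theta> - of_int p / Q)\<bar> \<le> 1 / (2 * Q)" .
  have "1 / Q \<le> \<bar>(of_int m * of_int p - of_int r * Q) / Q\<bar>"
    using one Q by (simp add: Q_def divide_right_mono)
  moreover have "1 / Q = 1 / (2 * Q) + 1 / (2 * Q)" by simp
  moreover have "c \<le> \<bar>x + y\<bar>" if "c + c \<le> \<bar>x\<bar>" "\<bar>y\<bar> \<le> c" for c x y :: real
    using that by linarith
  ultimately have "1 / (2 * Q) \<le> \<bar>real_of_int m * \<theta> - of_int r\<bar>"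
    using 1 unfolding eq by metis
  then show ?thesis by (simp add: Q_def)
qed

text \<open>This collects what the small divisor estimate takes from continued fractions. The index
  is shifted: \<open>q k\<close> is the denominator of \<open>[0; a_1, ..., a_(k+1)]\<close>, so
  every \<open>q k\<close> is at least \<open>1\<close> and no logarithm is negative.\<close>

lemma brjuno_denominators:
  assumes "brjuno \<theta>"
  obtains q :: "nat \<Rightarrow> real" where
    "\<And>k. q k \<ge> real k + 1"
    "\<And>k m r. 0 < m \<Longrightarrow> 2 * real_of_int m \<le> q k \<Longrightarrow> 1 / (2 * q k) \<le> \<bar>of_int m * \<theta> - of_int r\<bar>"
    "summable (\<lambda>k. ln (q (Suc k)) / q k)"
proof
  note \<theta> = assms[unfolded brjuno_def]
  let ?q = "\<lambda>k. real_of_int (convergent_denom \<theta> (Suc k))"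
  show "?q k \<ge> real k + 1" for k
    using convergent_denom_ge[of \<theta> k] \<theta> by linarith
  show "summable (\<lambda>k. ln (?q (Suc k)) / ?q k)" using \<theta> by simp
  show "1 / (2 * ?q k) \<le> \<bar>of_int m * \<theta> - of_int r\<bar>" if "0 < m" "2 * real_of_int m \<le> ?q k" for k m r
  proof -
    obtain p where "coprime p (convergent_denom \<theta> (Suc k))" "convergent_denom \<theta> (Suc k) > 0"
      "\<bar>\<theta> - of_int p / ?q k\<bar> \<le> 1 / (?q k)\<^sup>2"
      using convergent_approx[of \<theta> "Suc k"] \<theta> by blast
    from rational_approx_distance[OF this that(1), of r] that show ?thesis by linarith
  qed
qed

section \<open>Small divisors\<close>

text \<open>The function grows with slope \<open>2 / q\<close>, but is flat on a stretch of length \<open>q / 2\<close> before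
  each element of \<open>A\<close>, so that it can jump by \<open>1\<close> there without losing superadditivity.\<close>

lemma superadditive_gap_counting:
  fixes A :: "nat set" and q :: real
  assumes q: "q > 0"
    and gap: "\<And>a b. a \<in> A \<Longrightarrow> b \<in> A \<Longrightarrow> a < b \<Longrightarrow> real a + q \<le> real b"
    and start: "\<And>a. a \<in> A \<Longrightarrow> q \<le> real a"
  obtains F :: "nat \<Rightarrow> real" where
    "\<And>n. 0 \<le> F n" "\<And>n. F n \<le> 2 * real n / q"
    "\<And>m n. F m + F n \<le> F (m + n)"
    "\<And>n. Suc n \<in> A \<Longrightarrow> F n + 1 \<le> F (Suc n)"
proof
  define nxt where "nxt = (\<lambda>n. LEAST b. b \<in> A \<and> n < b)"
  \<comment> \<open>The two terms of the minimum agree at distance \<open>q / 2\<close> before the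
    next element of \<open>A\<close>; from there on the second one keeps \<open>F\<close> constant.
    At the element itself the cap moves on to a later element, at least \<open>q\<close> away, which
    leaves room for the jump by \<open>1\<close>.\<close>
  define F where "F = (\<lambda>n. if real n < q then 0
     else if \<exists>b\<in>A. n < b then min (2 * real n / q - 1) (2 * real (nxt n) / q - 2)
     else 2 * real n / q - 1)"
  have nxt: "nxt n \<in> A" "n < nxt n" if "\<exists>b\<in>A. n < b" for n
    using LeastI_ex[of "\<lambda>b. b \<in> A \<and> n < b"] that by (auto simp: nxt_def)
  have nxt_le: "nxt n \<le> b" if "b \<in> A" "n < b" for n b
    unfolding nxt_def by (rule Least_le) (use that in auto)
  have zero: "F n = 0" if "real n < q" for n
    using that by (simp add: F_def)
  have upper: "F n \<le> 2 * real n / q - 1" if "q \<le> real n" for n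
    using that by (auto simp: F_def)
  have upper': "F n \<le> 2 * real b / q - 2" if "b \<in> A" "n < b" for n b
  proof (cases "real n < q")
    case True
    then show ?thesis using start[OF that(1)] q by (simp add: F_def field_simps)
  next
    case False
    have "2 * real (nxt n) / q - 2 \<le> 2 * real b / q - 2"
      using nxt_le[OF that] q by (simp add: divide_right_mono)
    then show ?thesis using False that by (auto simp: F_def min_le_iff_disj)
  qed
  have lower: "x \<le> F n" if "q \<le> real n" "x \<le> 2 * real n / q - 1"
      "\<And>b. b \<in> A \<Longrightarrow> n < b \<Longrightarrow> x \<le> 2 * real b / q - 2" for n x
    using that nxt[of n] by (auto simp: F_def)
  have lower2: "2 * real n / q - 2 \<le> F n" if "q \<le> real n" for n
  proof (rule lower[OF that])
    fix b assume "b \<in> A" "n < b"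
    then show "2 * real n / q - 2 \<le> 2 * real b / q - 2" using q by (simp add: divide_right_mono)
  qed simp
  show nonneg: "0 \<le> F n" for n
  proof (cases "real n < q")
    case False
    then have "2 * real n / q - 2 \<ge> 0" using q by (simp add: field_simps)
    then show ?thesis using lower2[of n] False by simp
  qed (simp add: F_def)
  show "F n \<le> 2 * real n / q" for n
    using upper[of n] q by (cases "real n < q") (auto simp: F_def)
  have mono: "F m \<le> F n" if "m \<le> n" for m n
  proof (cases "real m < q")
    case True
    then show ?thesis using nonneg[of n] zero by simp
  next
    case False
    show ?thesis
    proof (rule lower)
      have "2 * real m / q \<le> 2 * real n / q" using that q by (simp add: divide_right_mono)
      then show "F m \<le> 2 * real n / q - 1" using upper[of m] False by simp
    qed (use that False upper' in \<open>auto\<close>)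
  qed
  \<comment> \<open>Below \<open>q\<close> the function vanishes, so monotonicity suffices.
    Otherwise each summand loses \<open>1\<close> against the line of slope \<open>2 / q\<close>,
    and the sum may lose \<open>2\<close> by \<open>lower2\<close>.\<close>
  show "F m + F n \<le> F (m + n)" for m n
  proof (cases "real m < q \<or> real n < q")
    case True
    then show ?thesis using mono[of n "m + n"] mono[of m "m + n"] zero by auto
  next
    case False
    then have "F m + F n \<le> (2 * real m / q - 1) + (2 * real n / q - 1)"
      by (intro add_mono upper) auto
    also have "\<dots> = 2 * real (m + n) / q - 2" by (simp add: add_divide_distrib)
    also have "\<dots> \<le> F (m + n)" using False by (intro lower2) auto
    finally show ?thesis .
  qed
  show "F n + 1 \<le> F (Suc n)" if "Suc n \<in> A" for n
  proof (rule lower)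
    show "q \<le> real (Suc n)" using start[OF that] .
    have le: "F n \<le> 2 * real (Suc n) / q - 2" using upper'[OF that] by simp
    then show "F n + 1 \<le> 2 * real (Suc n) / q - 1" by simp
    fix b assume "b \<in> A" "Suc n < b"
    then have "real (Suc n) + q \<le> real b" using gap that by blast
    then have "2 * (real (Suc n) + q) / q \<le> 2 * real b / q" using q by (simp add: divide_right_mono)
    moreover have "2 * (real (Suc n) + q) / q = 2 * real (Suc n) / q + 2"
      using q by (simp add: field_simps)
    ultimately show "F n + 1 \<le> 2 * real b / q - 2" using le by simp
  qed
qed

section \<open>Small divisors and the distance to the integers\<close>

lemma sin_ge_half:
  fixes y :: real
  assumes "0 \<le> y" "y \<le> pi / 2"
  shows "y / 2 \<le> sin y"
proof -
  have "\<bar>sin y - (\<Sum>m<3. sin_coeff m * y ^ m)\<bar> \<le> inverse (fact 3) * \<bar>y\<bar> ^ 3"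
    by (rule Maclaurin_sin_bound)
  also have "(\<Sum>m<3. sin_coeff m * y ^ m) = y"
    by (simp add: numeral_3_eq_3 sin_coeff_def)
  finally have "\<bar>sin y - y\<bar> \<le> y ^ 3 / 6" using assms by (simp add: fact_numeral)
  also have "y ^ 3 / 6 = y * (y * y / 6)" by (simp add: power3_eq_cube)
  also have "\<dots> \<le> y * (1 / 2)"
  proof -
    have "y \<le> 1.7" using assms pi_less_4 pi_approx by simp
    then have "y * y \<le> 1.7 * 1.7" using assms by (intro mult_mono) auto
    then show ?thesis using assms by (intro mult_left_mono) auto
  qed
  finally show ?thesis by linarith
qed

text \<open>For the nearest integer, at signed distance \<open>d\<close>, the chord has length
  \<open>2 * sin (pi * \<bar>d\<bar>)\<close>, and \<open>sin y\<close> is at least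
  \<open>y / 2\<close> on this range; the factor \<open>pi\<close> more than compensates the
  loss.\<close>

lemma norm_exp_minus_1_ge:
  fixes x :: real
  obtains r :: int where "\<bar>x - r\<bar> \<le> norm (exp (2 * complex_of_real pi * \<i> * complex_of_real x) - 1)"
proof
  define d where "d = x - of_int (round x)"
  have d: "\<bar>d\<bar> \<le> 1 / 2" using of_int_round_abs_le[of x] by (simp add: d_def abs_minus_commute)
  have x: "x = d + of_int (round x)" by (simp add: d_def)
  have "exp (2 * complex_of_real pi * \<i> * complex_of_real x)
      = exp (\<i> * of_real (2 * pi * d) + complex_of_real (2 * of_int (round x) * pi) * \<i>)"
    by (subst x) (simp add: algebra_simps)
  also have "\<dots> = exp (\<i> * of_real (2 * pi * d))"
    using exp_plus_2pin[of "\<i> * of_real (2 * pi * d)" "round x"] by (simp add: mult_ac)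
  finally have "norm (exp (2 * complex_of_real pi * \<i> * complex_of_real x) - 1) = 2 * \<bar>sin (pi * d)\<bar>"
    using dist_exp_i_1[of "2 * pi * d"] by simp
  also have "\<bar>sin (pi * d)\<bar> = sin (pi * \<bar>d\<bar>)"
  proof -
    have "sin (pi * \<bar>d\<bar>) \<ge> 0" using d by (intro sin_ge_zero) auto
    then show ?thesis by (cases "d \<ge> 0") auto
  qed
  also have "2 * sin (pi * \<bar>d\<bar>) \<ge> 2 * (pi * \<bar>d\<bar> / 2)"
    using d by (intro mult_left_mono sin_ge_half) auto
  moreover have "2 * (pi * \<bar>d\<bar> / 2) \<ge> 1 * \<bar>d\<bar>"
    using mult_right_mono[of 1 pi "\<bar>d\<bar>"] pi_ge_two by simp
  ultimately show "\<bar>x - of_int (round x)\<bar> \<le> norm (exp (2 * complex_of_real pi * \<i> * complex_of_real x) - 1)"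
    by (simp add: d_def)
qed

text \<open>For each \<open>k\<close> a superadditive function counts the indices whose divisor is
  small at scale \<open>1 / q k\<close>; \<open>K\<close> adds these functions with weights
  \<open>ln (q (Suc k))\<close>. Each grows at most like \<open>4 * n / q k\<close>, so the Brjuno
  sum makes \<open>K\<close> finite and of linear growth, while its jumps dominate the logarithms of
  the inverse divisors.\<close>

lemma brjuno_small_divisors:
  assumes "brjuno \<theta>"
  defines "\<rho> \<equiv> exp (2 * complex_of_real pi * \<i> * complex_of_real \<theta>)"
  obtains K :: "nat \<Rightarrow> real" and C :: real where
    "\<And>n. 0 \<le> K n" "\<And>n. K n \<le> C * real n" "\<And>m n. K m + K n \<le> K (m + n)"
    "\<And>n. exp (K n) \<le> exp (K (Suc n)) * norm (\<rho> ^ Suc n - 1)"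
proof -
  obtain q :: "nat \<Rightarrow> real" where q1: "\<And>k. q k \<ge> real k + 1"
    and q2: "\<And>k m r. 0 < m \<Longrightarrow> 2 * real_of_int m \<le> q k \<Longrightarrow> 1 / (2 * q k) \<le> \<bar>of_int m * \<theta> - of_int r\<bar>"
    and q3: "summable (\<lambda>k. ln (q (Suc k)) / q k)"
    using brjuno_denominators[OF assms(1)] by blast
  have q_pos: "q k > 0" "q k \<ge> 1" for k using q1[of k] by auto
  define A where "A = (\<lambda>k. {n::nat. n > 0 \<and> (\<exists>r::int. \<bar>real n * \<theta> - r\<bar> < 1 / (4 * q k))})"
  \<comment> \<open>Two elements closer than this would have a difference \<open>m\<close> with
    \<open>m * \<theta>\<close> nearer than \<open>1 / (2 * q k)\<close> to an integer. Admitting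
    \<open>a = 0\<close> bounds the first element of \<open>A k\<close> by the same
    argument.\<close>
  have A_gap: "real a + q k / 2 \<le> real b" if ab: "a < b" "a = 0 \<or> a \<in> A k" "b \<in> A k" for a b k
  proof (rule ccontr)
    assume "\<not> ?thesis"
    then have small: "2 * real_of_int (int b - int a) \<le> q k" by simp
    obtain r where r: "\<bar>real a * \<theta> - of_int r\<bar> < 1 / (4 * q k)"
    proof (cases "a = 0")
      case True
      then show ?thesis using that[of 0] q_pos(1)[of k] by simp
    next
      case False
      then show ?thesis using that ab(2) by (auto simp: A_def)
    qed
    obtain s where s: "\<bar>real b * \<theta> - of_int s\<bar> < 1 / (4 * q k)"
      using ab(3) by (auto simp: A_def)
    have "1 / (2 * q k) \<le> \<bar>of_int (int b - int a) * \<theta> - of_int (s - r)\<bar>"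
      using ab(1) small by (intro q2) auto
    also have "of_int (int b - int a) * \<theta> - of_int (s - r)
        = (real b * \<theta> - of_int s) - (real a * \<theta> - of_int r)" by (simp add: algebra_simps)
    finally have "1 / (2 * q k) < 1 / (4 * q k) + 1 / (4 * q k)" using r s by linarith
    then show False by simp
  qed
  have "\<exists>F :: nat \<Rightarrow> real. (\<forall>n. 0 \<le> F n) \<and> (\<forall>n. F n \<le> 2 * real n / (q k / 2)) \<and>
      (\<forall>m n. F m + F n \<le> F (m + n)) \<and> (\<forall>n. Suc n \<in> A k \<longrightarrow> F n + 1 \<le> F (Suc n))" for k
  proof -
    have "q k / 2 > 0" using q_pos[of k] by simp
    moreover have "q k / 2 \<le> real a" if "a \<in> A k" for a
      using A_gap[of 0 a k] that by (auto simp: A_def)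
    moreover have "real a + q k / 2 \<le> real b" if "a \<in> A k" "b \<in> A k" "a < b" for a b
      using A_gap that by blast
    ultimately show ?thesis by (metis superadditive_gap_counting[of "q k / 2" "A k"])
  qed
  then obtain F :: "nat \<Rightarrow> nat \<Rightarrow> real" where F0: "\<And>k n. 0 \<le> F k n"
    and F1: "\<And>k n. F k n \<le> 2 * real n / (q k / 2)"
    and F2: "\<And>k m n. F k m + F k n \<le> F k (m + n)"
    and F3: "\<And>k n. Suc n \<in> A k \<Longrightarrow> F k n + 1 \<le> F k (Suc n)"
    by metis
  define l where "l = (\<lambda>k. ln (q (Suc k)))"
  have l0: "l k \<ge> 0" for k using q_pos(2) by (simp add: l_def)
  have sums: "summable (\<lambda>k. F k n * l k)" for n
  proof (rule summable_comparison_test')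
    show "summable (\<lambda>k. 4 * real n * (ln (q (Suc k)) / q k))" by (intro summable_mult q3)
    show "norm (F k n * l k) \<le> 4 * real n * (ln (q (Suc k)) / q k)" for k
      using mult_right_mono[OF F1 l0, of k n k] F0[of k n] l0[of k]
      by (simp add: l_def mult_ac)
  qed
  \<comment> \<open>The first summand pays for the divisors outside \<open>A 0\<close>; the second
    pays for the factor \<open>4\<close> in the bound \<open>1 / (4 * q j)\<close> at later
    scales.\<close>
  define L where "L = ln (4 * q 0) + ln 4"
  have L: "L \<ge> 0" using q_pos(2)[of 0] by (simp add: L_def)
  define K where "K = (\<lambda>n. real n * L + (\<Sum>k. F k n * l k))"
  show thesis
  proof (rule that)
    show "0 \<le> K n" for n
      unfolding K_def using L F0 l0 by (intro add_nonneg_nonneg suminf_nonneg sums) auto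
    show "K n \<le> (L + 4 * (\<Sum>k. ln (q (Suc k)) / q k)) * real n" for n
    proof -
      have "(\<Sum>k. F k n * l k) \<le> (\<Sum>k. 4 * real n * (ln (q (Suc k)) / q k))"
      proof (intro suminf_le sums summable_mult q3)
        show "F k n * l k \<le> 4 * real n * (ln (q (Suc k)) / q k)" for k
          using mult_right_mono[OF F1 l0, of k n k] by (simp add: l_def mult_ac)
      qed
      also have "\<dots> = 4 * real n * (\<Sum>k. ln (q (Suc k)) / q k)"
        by (intro suminf_mult q3)
      finally show ?thesis by (simp add: K_def algebra_simps)
    qed
    show "K m + K n \<le> K (m + n)" for m n
    proof -
      have "(\<Sum>k. F k m * l k) + (\<Sum>k. F k n * l k) = (\<Sum>k. F k m * l k + F k n * l k)"
        by (intro suminf_add sums)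
      also have "\<dots> \<le> (\<Sum>k. F k (m + n) * l k)"
      proof (intro suminf_le summable_add sums)
        show "F k m * l k + F k n * l k \<le> F k (m + n) * l k" for k
          using mult_right_mono[OF F2 l0, of k m n k] by (simp add: distrib_right)
      qed
      finally show ?thesis by (simp add: K_def algebra_simps)
    qed
    show "exp (K n) \<le> exp (K (Suc n)) * norm (\<rho> ^ Suc n - 1)" for n
    proof -
      have F_mono: "F k n \<le> F k (Suc n)" for k using F2[of k n 1] F0[of k 1] by simp
      obtain r :: int where r: "\<bar>real (Suc n) * \<theta> - r\<bar>
          \<le> norm (exp (2 * complex_of_real pi * \<i> * complex_of_real (real (Suc n) * \<theta>)) - 1)"
        using norm_exp_minus_1_ge by blast
      have "exp (2 * complex_of_real pi * \<i> * complex_of_real (real (Suc n) * \<theta>)) = \<rho> ^ Suc n"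
        unfolding \<rho>_def exp_of_nat_mult[symmetric] by (simp add: algebra_simps)
      note r = r[unfolded this]
      define d where "d = \<bar>real (Suc n) * \<theta> - r\<bar>"
      have "\<theta> \<notin> \<rat>" using assms(1) by (simp add: brjuno_def)
      have d_pos: "d > 0"
      proof (rule ccontr)
        assume "\<not> d > 0"
        then have "real (Suc n) * \<theta> = r" by (simp add: d_def)
        then have "\<theta> = of_int r / of_nat (Suc n)" by (simp add: field_simps)
        also have "\<dots> \<in> \<rat>" by (intro Rats_divide) auto
        finally show False using \<open>\<theta> \<notin> \<rat>\<close> by simp
      qed
      have "\<exists>j. ln (4 * q j) \<le> K (Suc n) - K n \<and> 1 / (4 * q j) \<le> d"
      proof (cases "Suc n \<in> A 0")
        case False
        have "(\<Sum>k. F k n * l k) \<le> (\<Sum>k. F k (Suc n) * l k)"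
          by (intro suminf_le sums mult_right_mono F_mono l0)
        then have "ln (4 * q 0) \<le> K (Suc n) - K n"
          by (simp add: K_def L_def algebra_simps add_increasing)
        moreover have "1 / (4 * q 0) \<le> d" using False by (auto simp: A_def d_def not_less)
        ultimately show ?thesis by blast
      next
        case True
        \<comment> \<open>The distance of \<open>(n + 1) * \<theta>\<close> to the integers is
          positive by irrationality, while \<open>1 / (4 * q j)\<close> tends to
          \<open>0\<close>.\<close>
        have "\<exists>j. Suc n \<notin> A j"
        proof -
          define d0 where "d0 = \<bar>real (Suc n) * \<theta> - of_int (round (real (Suc n) * \<theta>))\<bar>"
          have "d0 > 0"
          proof (rule ccontr)
            assume "\<not> d0 > 0"
            then have "real (Suc n) * \<theta> = of_int (round (real (Suc n) * \<theta>))" by (simp add: d0_def)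
            then have "\<theta> = of_int (round (real (Suc n) * \<theta>)) / of_nat (Suc n)" by (simp add: field_simps)
            also have "\<dots> \<in> \<rat>" by (intro Rats_divide) auto
            finally show False using \<open>\<theta> \<notin> \<rat>\<close> by simp
          qed
          obtain j where j: "real j > 1 / d0" using reals_Archimedean2 by blast
          have "1 / (4 * q j) < d0"
          proof -
            have "1 / d0 < 4 * q j" using q1[of j] j by linarith
            then show ?thesis using \<open>d0 > 0\<close> q_pos(1)[of j] by (simp add: field_simps)
          qed
          moreover have "d0 \<le> \<bar>real (Suc n) * \<theta> - of_int s\<bar>" for s
            unfolding d0_def using round_diff_minimal[of "real (Suc n) * \<theta>" s] by simp
          ultimately have "\<not> \<bar>real (Suc n) * \<theta> - of_int s\<bar> < 1 / (4 * q j)" for s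
            by (meson less_asym less_le_trans)
          then have "Suc n \<notin> A j" unfolding A_def by blast
          then show ?thesis ..
        qed
        \<comment> \<open>By minimality the index still lies in \<open>A i\<close> with
          \<open>j = Suc i\<close>. Hence \<open>F i\<close> jumps by at least \<open>1\<close> and
          \<open>K\<close> by at least \<open>L + ln (q j)\<close>, which pays for the divisor bound
          \<open>1 / (4 * q j)\<close>.\<close>
        define j where "j = (LEAST j. Suc n \<notin> A j)"
        have j: "Suc n \<notin> A j" unfolding j_def by (rule LeastI_ex) fact
        have "j \<noteq> 0" using j True by metis
        then obtain i where i: "j = Suc i" by (cases j) auto
        have iA: "Suc n \<in> A i" using not_less_Least[of i "\<lambda>j. Suc n \<notin> A j"] i j_def by auto
        have "l i \<le> (\<Sum>k. (F k (Suc n) - F k n) * l k)"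
        proof -
          have "l i \<le> (F i (Suc n) - F i n) * l i"
            using mult_right_mono[OF _ l0, of 1 "F i (Suc n) - F i n" i] F3[OF iA] by simp
          also have "\<dots> = (\<Sum>k\<in>{i}. (F k (Suc n) - F k n) * l k)" by simp
          also have "\<dots> \<le> (\<Sum>k. (F k (Suc n) - F k n) * l k)"
          proof (rule sum_le_suminf)
            show "summable (\<lambda>k. (F k (Suc n) - F k n) * l k)"
              using summable_diff[OF sums sums, of "Suc n" n] by (simp add: left_diff_distrib)
            show "0 \<le> (F k (Suc n) - F k n) * l k" for k using F_mono l0 by simp
          qed auto
          finally show ?thesis .
        qed
        also have "\<dots> = (\<Sum>k. F k (Suc n) * l k) - (\<Sum>k. F k n * l k)"
          unfolding suminf_diff[OF sums sums] by (simp add: left_diff_distrib)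
        finally have "L + l i \<le> K (Suc n) - K n" by (simp add: K_def algebra_simps)
        moreover have "ln (4 * q j) \<le> L + l i"
          using q_pos[of j] q_pos[of 0] by (simp add: L_def l_def i ln_mult)
        moreover have "1 / (4 * q j) \<le> d" using j by (auto simp: A_def d_def not_less)
        ultimately show ?thesis by (meson order_trans)
      qed
      then obtain j where j: "ln (4 * q j) \<le> K (Suc n) - K n" "1 / (4 * q j) \<le> d" by blast
      have "exp (K n) * (4 * q j) = exp (K n + ln (4 * q j))"
        using q_pos(1)[of j] by (simp add: exp_add)
      also have "\<dots> \<le> exp (K (Suc n))" using j(1) by simp
      finally have "exp (K n) \<le> exp (K (Suc n)) * (1 / (4 * q j))"
        using q_pos(1)[of j] by (simp add: field_simps)
      also have "\<dots> \<le> exp (K (Suc n)) * norm (\<rho> ^ Suc n - 1)"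
        using j(2) r by (intro mult_left_mono) (auto simp: d_def)
      finally show ?thesis .
    qed
  qed
qed

section \<open>Linearization\<close>

text \<open>These are the coefficients of the solution of \<open>G(H(z)) = H(\<rho> * z)\<close>
  tangent to the identity. The series under the power is cut off below \<open>n\<close> to make the
  recursion well-founded; the cut does not alter the coefficient, as the exponents are at least
  \<open>2\<close> and the constant term is \<open>0\<close>.\<close>

function linearizing_coeff :: "complex fps \<Rightarrow> complex \<Rightarrow> nat \<Rightarrow> complex" where
  "linearizing_coeff G \<rho> n = (if n = 0 then 0 else if n = 1 then 1
     else (\<Sum>j=2..n. fps_nth G j *
             fps_nth (Abs_fps (\<lambda>i. if i < n then linearizing_coeff G \<rho> i else 0) ^ j) n) /
          (\<rho> ^ n - \<rho>))"
  by auto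
termination by (relation "Wellfounded.measure (\<lambda>(_, _, n). n)") auto

declare linearizing_coeff.simps [simp del]

definition linearizing_fps :: "complex fps \<Rightarrow> complex \<Rightarrow> complex fps" where
  "linearizing_fps G \<rho> = Abs_fps (linearizing_coeff G \<rho>)"

lemma fps_power_nth_cong:
  assumes "\<And>i. i < n \<Longrightarrow> fps_nth A i = fps_nth B i" "m < n"
  shows "fps_nth (A ^ j) m = fps_nth (B ^ j) m"
  using assms(2)
proof (induction j arbitrary: m)
  case (Suc j)
  show ?case unfolding power_Suc fps_mult_nth
    by (intro sum.cong refl arg_cong2[where f = "(*)"] assms(1) Suc.IH) (use Suc.prems in auto)
qed simp

text \<open>In the product \<open>A * A ^ (j - 1)\<close> the coefficient of index \<open>n\<close>
  of either factor meets a constant term, which is \<open>0\<close>. So only smaller indices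
  contribute, and this justifies the cut-off in \<open>linearizing_coeff\<close>.\<close>

lemma fps_power_nth_cong_Suc:
  fixes A B :: "'a::comm_ring_1 fps"
  assumes eq: "\<And>i. i < n \<Longrightarrow> fps_nth A i = fps_nth B i"
    and zero: "fps_nth A 0 = 0" "fps_nth B 0 = 0" and j: "2 \<le> j"
  shows "fps_nth (A ^ j) n = fps_nth (B ^ j) n"
proof -
  obtain k where k: "j = Suc (Suc k)" using j by (metis Suc_le_D numeral_2_eq_2 Suc_le_mono)
  show ?thesis unfolding k power_Suc[of _ "Suc k"] fps_mult_nth
  proof (rule sum.cong[OF refl])
    fix i assume i: "i \<in> {0..n}"
    consider "i = 0" | "i = n" | "0 < i" "i < n" using i by force
    then show "fps_nth A i * fps_nth (A ^ Suc k) (n - i) = fps_nth B i * fps_nth (B ^ Suc k) (n - i)"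
    proof cases
      case 3
      then show ?thesis using eq fps_power_nth_cong[of n A B "n - i" "Suc k", OF eq] by simp
    qed (use zero in simp_all)
  qed
qed

lemma linearizing_fps_nth:
  fixes G :: "complex fps" and \<rho> :: complex
  assumes "\<forall>n\<ge>2. \<rho> ^ n \<noteq> \<rho>"
  defines "H \<equiv> linearizing_fps G \<rho>"
  shows "fps_nth H 0 = 0" "fps_nth H (Suc 0) = 1"
    "n \<ge> 2 \<Longrightarrow> (\<rho> ^ n - \<rho>) * fps_nth H n = (\<Sum>j=2..n. fps_nth G j * fps_nth (H ^ j) n)"
proof -
  show H0: "fps_nth H 0 = 0" and "fps_nth H (Suc 0) = 1"
    by (simp_all add: H_def linearizing_fps_def linearizing_coeff.simps)
  assume n: "n \<ge> 2"
  define T where "T = Abs_fps (\<lambda>i. if i < n then linearizing_coeff G \<rho> i else 0)"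
  have T: "fps_nth T i = fps_nth H i" if "i < n" for i
    using that by (simp add: T_def H_def linearizing_fps_def)
  have "fps_nth H n = (\<Sum>j=2..n. fps_nth G j * fps_nth (T ^ j) n) / (\<rho> ^ n - \<rho>)"
    using n unfolding H_def linearizing_fps_def fps_nth_Abs_fps T_def
    by (subst linearizing_coeff.simps) simp
  also have "(\<Sum>j=2..n. fps_nth G j * fps_nth (T ^ j) n) = (\<Sum>j=2..n. fps_nth G j * fps_nth (H ^ j) n)"
    by (intro sum.cong refl arg_cong2[where f = "(*)"] fps_power_nth_cong_Suc T) (use T H0 n in auto)
  finally show "(\<rho> ^ n - \<rho>) * fps_nth H n = (\<Sum>j=2..n. fps_nth G j * fps_nth (H ^ j) n)"
    using assms(1) n by simp
qed

lemma linearizing_fps_compose: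
  fixes G :: "complex fps" and \<rho> :: complex
  assumes "\<forall>n\<ge>2. \<rho> ^ n \<noteq> \<rho>" "fps_nth G 0 = 0" "fps_nth G 1 = \<rho>"
  defines "H \<equiv> linearizing_fps G \<rho>"
  shows "fps_compose G H = fps_compose H (fps_const \<rho> * fps_X)"
proof (rule fps_ext)
  fix n
  note H = linearizing_fps_nth[where \<rho> = \<rho> and G = G, OF assms(1), folded H_def]
  have "fps_nth (fps_compose G H) n = \<rho> ^ n * fps_nth H n"
  proof -
    consider "n = 0" | "n = 1" | "n \<ge> 2" by force
    then show ?thesis
    proof cases
      case 3
      have "{0..n} = insert 0 (insert 1 {2..n})" using 3 by auto
      then have "fps_nth (fps_compose G H) n = \<rho> * fps_nth H n + (\<Sum>j=2..n. fps_nth G j * fps_nth (H ^ j) n)"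
        using assms by (simp add: fps_compose_nth)
      then show ?thesis unfolding H(3)[OF 3, symmetric] by (simp add: algebra_simps)
    qed (use assms H in \<open>simp_all add: fps_compose_nth\<close>)
  qed
  then show "fps_nth (fps_compose G H) n = fps_nth (fps_compose H (fps_const \<rho> * fps_X)) n"
    by (simp add: fps_compose_linear)
qed

section \<open>Partial sums of majorant series\<close>

definition fps_psum :: "real \<Rightarrow> real fps \<Rightarrow> nat \<Rightarrow> real" where
  "fps_psum r A N = (\<Sum>n\<le>N. fps_nth A n * r ^ n)"

lemma fps_power_nonneg:
  fixes A :: "real fps"
  assumes "\<And>n. 0 \<le> fps_nth A n"
  shows "0 \<le> fps_nth (A ^ j) n"
proof (induction j arbitrary: n)
  case (Suc j)
  then show ?case unfolding power_Suc fps_mult_nth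
    by (intro sum_nonneg mult_nonneg_nonneg assms)
qed simp

lemma fps_psum_mult:
  "fps_psum r (A * B) N = (\<Sum>(i, k) | i + k \<le> N. (fps_nth A i * r ^ i) * (fps_nth B k * r ^ k))"
proof -
  have "fps_psum r (A * B) N = (\<Sum>n\<le>N. \<Sum>i\<le>n. (fps_nth A i * r ^ i) * (fps_nth B (n - i) * r ^ (n - i)))"
    unfolding fps_psum_def fps_mult_nth sum_distrib_right atLeast0AtMost
  proof (intro sum.cong refl)
    fix n i :: nat assume "i \<in> {..n}"
    then have "r ^ n = r ^ i * r ^ (n - i)" by (simp flip: power_add)
    then show "fps_nth A i * fps_nth B (n - i) * r ^ n = fps_nth A i * r ^ i * (fps_nth B (n - i) * r ^ (n - i))"
      by simp
  qed
  then show ?thesis by (simp only: sum.triangle_reindex_eq)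
qed

lemma fps_psum_mult_le:
  assumes "r \<ge> 0" "\<And>n. 0 \<le> fps_nth A n" "\<And>n. 0 \<le> fps_nth B n"
  shows "fps_psum r (A * B) N \<le> fps_psum r A N * fps_psum r B N"
proof -
  have "(\<Sum>(i, k) | i + k \<le> N. (fps_nth A i * r ^ i) * (fps_nth B k * r ^ k))
      \<le> (\<Sum>(i, k) \<in> {..N} \<times> {..N}. (fps_nth A i * r ^ i) * (fps_nth B k * r ^ k))"
    by (rule sum_mono2) (use assms in auto)
  then show ?thesis
    by (simp only: fps_psum_mult fps_psum_def[of r A] fps_psum_def[of r B] sum_product sum.cartesian_product)
qed

text \<open>Without constant terms only pairs of positive indices contribute, and
  \<open>i + k \<le> N + 1\<close> then forces both to be at most \<open>N\<close>. This gain of one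
  index makes the induction on partial sums in the majorant argument possible.\<close>

lemma fps_psum_mult_le_Suc:
  assumes "r \<ge> 0" "\<And>n. 0 \<le> fps_nth A n" "\<And>n. 0 \<le> fps_nth B n"
    and zero: "fps_nth A 0 = 0" "fps_nth B 0 = 0"
  shows "fps_psum r (A * B) (Suc N) \<le> fps_psum r A N * fps_psum r B N"
proof -
  have fin: "finite {(i, k). i + k \<le> Suc N}"
    by (rule finite_subset[of _ "{..Suc N} \<times> {..Suc N}"]) auto
  have "(\<Sum>(i, k) | i + k \<le> Suc N. (fps_nth A i * r ^ i) * (fps_nth B k * r ^ k))
      = (\<Sum>(i, k) | i + k \<le> Suc N \<and> 0 < i \<and> 0 < k. (fps_nth A i * r ^ i) * (fps_nth B k * r ^ k))"
    by (rule sum.mono_neutral_right[OF fin]) (use zero in \<open>auto intro!: gr0I\<close>)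
  also have "\<dots> \<le> (\<Sum>(i, k) \<in> {..N} \<times> {..N}. (fps_nth A i * r ^ i) * (fps_nth B k * r ^ k))"
    by (rule sum_mono2) (use assms in auto)
  finally show ?thesis
    by (simp only: fps_psum_mult fps_psum_def[of r A] fps_psum_def[of r B] sum_product sum.cartesian_product)
qed

lemma fps_psum_nonneg: "r \<ge> 0 \<Longrightarrow> (\<And>n. 0 \<le> fps_nth A n) \<Longrightarrow> 0 \<le> fps_psum r A N"
  by (auto simp: fps_psum_def intro!: sum_nonneg)

lemma fps_psum_power_le:
  assumes "r \<ge> 0" "\<And>n. 0 \<le> fps_nth A n"
  shows "fps_psum r (A ^ j) N \<le> fps_psum r A N ^ j"
proof (induction j)
  case 0
  then show ?case by (simp add: fps_psum_def if_distrib[of "\<lambda>x. x * _"] cong: if_cong)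
next
  case (Suc j)
  have "fps_psum r (A ^ Suc j) N \<le> fps_psum r A N * fps_psum r (A ^ j) N"
    unfolding power_Suc by (intro fps_psum_mult_le assms fps_power_nonneg)
  also have "\<dots> \<le> fps_psum r A N * fps_psum r A N ^ j"
    by (intro mult_left_mono Suc fps_psum_nonneg assms)
  finally show ?case by simp
qed

lemma fps_psum_power_le_Suc:
  assumes "r \<ge> 0" "\<And>n. 0 \<le> fps_nth A n" "fps_nth A 0 = 0" "2 \<le> j"
  shows "fps_psum r (A ^ j) (Suc N) \<le> fps_psum r A N ^ j"
proof -
  obtain k where k: "j = Suc (Suc k)" using assms(4) by (metis Suc_le_D numeral_2_eq_2 Suc_le_mono)
  have "fps_psum r (A ^ j) (Suc N) \<le> fps_psum r A N * fps_psum r (A ^ Suc k) N"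
    unfolding k power_Suc[of A "Suc k"]
    by (intro fps_psum_mult_le_Suc assms fps_power_nonneg) (simp add: assms)
  also have "\<dots> \<le> fps_psum r A N * fps_psum r A N ^ Suc k"
    by (intro mult_left_mono fps_psum_power_le fps_psum_nonneg assms)
  finally show ?thesis by (simp add: k)
qed

text \<open>With \<open>K\<close> the exponent of the accumulated small divisors, the rescaled coefficients
  \<open>norm (fps_nth H n) * exp (- K (n - 1))\<close> satisfy a recursive inequality without small divisors.\<close>

lemma linearizing_fps_bound:
  fixes K :: "nat \<Rightarrow> real"
  assumes K0: "\<And>n. 0 \<le> K n" and K_add: "\<And>m n. K m + K n \<le> K (m + n)"
    and div: "\<And>n. exp (K n) \<le> exp (K (Suc n)) * norm (\<rho> ^ Suc n - 1)"
    and \<rho>: "norm \<rho> = 1"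
    and M: "M > 0" "\<And>j. 2 \<le> j \<Longrightarrow> norm (fps_nth G j) \<le> M ^ (j - 1)"
  shows "norm (fps_nth (linearizing_fps G \<rho>) n) * (1 / (6 * M)) ^ n \<le> (1 / (3 * M)) * exp (K (n - 1))"
proof -
  have \<rho>_pow: "norm (\<rho> ^ n - \<rho>) = norm (\<rho> ^ (n - 1) - 1)" if "n \<ge> 1" for n
  proof -
    have "\<rho> ^ n = \<rho> * \<rho> ^ (n - 1)" using that by (metis power_eq_if not_one_le_zero)
    then have "\<rho> ^ n - \<rho> = \<rho> * (\<rho> ^ (n - 1) - 1)" by (simp add: right_diff_distrib)
    then show ?thesis using \<rho> by (simp only: norm_mult mult_1)
  qed
  have nonres: "\<forall>n\<ge>2. \<rho> ^ n \<noteq> \<rho>"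
  proof (intro allI impI notI)
    fix n :: nat assume that: "n \<ge> 2"
    assume "\<rho> ^ n = \<rho>"
    then have "norm (\<rho> ^ (n - 1) - 1) = 0" using \<rho>_pow[of n] that by simp
    then have "norm (\<rho> ^ Suc (n - 2) - 1) = 0" using that by (simp add: Suc_diff_Suc numeral_2_eq_2)
    then show False using div[of "n - 2"] by (simp del: norm_eq_zero power_Suc)
  qed
  define H where "H = linearizing_fps G \<rho>"
  note H = linearizing_fps_nth[where \<rho> = \<rho> and G = G, OF nonres, folded H_def]
  define B where "B = Abs_fps (\<lambda>n. norm (fps_nth H n) * exp (- K (n - 1)))"
  have B_nonneg: "0 \<le> fps_nth B n" for n by (simp add: B_def)
  have B0: "fps_nth B 0 = 0" by (simp add: B_def H)
  have HB: "norm (fps_nth H n) = exp (K (n - 1)) * fps_nth B n" for n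
    by (simp add: B_def exp_minus)
  \<comment> \<open>A product of \<open>j\<close> coefficients with indices adding up to
    \<open>n\<close> carries arguments of \<open>K\<close> adding up to \<open>n - j\<close>, so
    superadditivity applies. Where the natural subtraction is truncated, the corresponding
    coefficient of \<open>B\<close> or of its power is \<open>0\<close>.\<close>
  have powers: "norm (fps_nth (H ^ j) n) \<le> exp (K (n - j)) * fps_nth (B ^ j) n" for j n
  proof (induction j arbitrary: n)
    case 0
    then show ?case using K0[of 0] by simp
  next
    case (Suc j)
    have "norm (fps_nth (H ^ Suc j) n) \<le> (\<Sum>i=0..n. norm (fps_nth H i * fps_nth (H ^ j) (n - i)))"
      unfolding power_Suc fps_mult_nth by (rule norm_sum)
    also have "\<dots> \<le> (\<Sum>i=0..n. exp (K (n - Suc j)) * (fps_nth B i * fps_nth (B ^ j) (n - i)))"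
    proof (rule sum_mono)
      fix i assume i: "i \<in> {0..n}"
      have "norm (fps_nth H i * fps_nth (H ^ j) (n - i))
          \<le> (exp (K (i - 1)) * fps_nth B i) * (exp (K (n - i - j)) * fps_nth (B ^ j) (n - i))"
        unfolding norm_mult HB
        by (intro mult_left_mono Suc mult_nonneg_nonneg B_nonneg) auto
      also have "\<dots> = exp (K (i - 1) + K (n - i - j)) * (fps_nth B i * fps_nth (B ^ j) (n - i))"
        by (simp add: exp_add)
      also have "\<dots> \<le> exp (K (n - Suc j)) * (fps_nth B i * fps_nth (B ^ j) (n - i))"
      proof (cases "i = 0 \<or> n - i < j")
        case True
        then have "fps_nth B i * fps_nth (B ^ j) (n - i) = 0"
          using B0 startsby_zero_power_prefix[OF B0] by auto
        then show ?thesis by (simp only: mult_zero_right order_refl)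
      next
        case False
        then have "(i - 1) + (n - i - j) = n - Suc j" using i by auto
        then show ?thesis using K_add[of "i - 1" "n - i - j"] B_nonneg fps_power_nonneg[OF B_nonneg]
          by (intro mult_right_mono) auto
      qed
      finally show "norm (fps_nth H i * fps_nth (H ^ j) (n - i))
          \<le> exp (K (n - Suc j)) * (fps_nth B i * fps_nth (B ^ j) (n - i))" .
    qed
    finally show ?case by (simp add: fps_mult_nth sum_distrib_left)
  qed
  have K_mono: "K m \<le> K n" if "m \<le> n" for m n
    using K_add[of m "n - m"] K0[of "n - m"] that by simp
  \<comment> \<open>The divisor at \<open>n\<close> costs the passage from \<open>K (n - 2)\<close>
    to \<open>K (n - 1)\<close>. Every term has \<open>j \<ge> 2\<close> and therefore carries at
    most \<open>K (n - 2)\<close>, so the exponentials cancel.\<close>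
  have B_rec: "fps_nth B n \<le> (\<Sum>j=2..n. M ^ (j - 1) * fps_nth (B ^ j) n)" if n: "n \<ge> 2" for n
  proof -
    define m where "m = n - 2"
    have m: "n - 1 = Suc m" "n - 2 = m" using n by (auto simp: m_def)
    have "exp (K m) * fps_nth B n \<le> exp (K (Suc m)) * norm (\<rho> ^ Suc m - 1) * fps_nth B n"
      by (intro mult_right_mono div B_nonneg)
    also have "\<dots> = norm ((\<rho> ^ n - \<rho>) * fps_nth H n)"
      using \<rho>_pow[of n] n unfolding norm_mult HB m(1) by (simp del: power_Suc)
    also have "\<dots> \<le> (\<Sum>j=2..n. norm (fps_nth G j * fps_nth (H ^ j) n))"
      unfolding H(3)[OF n] by (rule norm_sum)
    also have "\<dots> \<le> (\<Sum>j=2..n. M ^ (j - 1) * (exp (K m) * fps_nth (B ^ j) n))"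
    proof (rule sum_mono)
      fix j assume j: "j \<in> {2..n}"
      have "norm (fps_nth (H ^ j) n) \<le> exp (K (n - j)) * fps_nth (B ^ j) n" by (rule powers)
      also have "\<dots> \<le> exp (K m) * fps_nth (B ^ j) n"
        using j m by (intro mult_right_mono fps_power_nonneg B_nonneg) (auto intro: K_mono)
      finally show "norm (fps_nth G j * fps_nth (H ^ j) n) \<le> M ^ (j - 1) * (exp (K m) * fps_nth (B ^ j) n)"
        using j M unfolding norm_mult by (intro mult_mono) auto
    qed
    also have "\<dots> = exp (K m) * (\<Sum>j=2..n. M ^ (j - 1) * fps_nth (B ^ j) n)"
      by (simp add: sum_distrib_left mult_ac)
    finally show ?thesis by simp
  qed
  \<comment> \<open>The constant makes the bound \<open>2 * r\<close> on partial sums reproduce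
    itself: the next one is at most \<open>r\<close> plus the sum of
    \<open>M ^ (j - 1) * (2 * r) ^ j\<close> over \<open>j \<ge> 2\<close>, a geometric sum of ratio
    \<open>1 / 3\<close> bounded by \<open>r\<close>.\<close>
  define r where "r = 1 / (6 * M)"
  have r: "r > 0" "2 * r * M = 1 / 3" using M by (auto simp: r_def)
  have geom: "(\<Sum>j=2..Suc N. (1 / 3 :: real) ^ (j - 1)) \<le> 1 / 2" for N
  proof -
    have "(\<Sum>j=2..Suc N. (1 / 3 :: real) ^ (j - 1)) = (1 - (1 / 3) ^ N) / 2"
    proof (induction N)
      case (Suc N)
      have "(\<Sum>j=2..Suc (Suc N). (1 / 3 :: real) ^ (j - 1)) = (\<Sum>j=2..Suc N. (1 / 3) ^ (j - 1)) + (1 / 3) * (1 / 3) ^ N"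
        by simp
      then show ?case unfolding Suc by (simp add: field_simps)
    qed simp
    also have "\<dots> \<le> 1 / 2" by (simp add: power_le_one)
    finally show ?thesis .
  qed
  have S: "fps_psum r B N \<le> 2 * r" for N
  proof (induction N)
    case 0
    then show ?case using B0 r by (simp add: fps_psum_def)
  next
    case (Suc N)
    have "fps_psum r B (Suc N) \<le> (\<Sum>n\<le>Suc N. (if n = 1 then r else 0) +
        (\<Sum>j=2..Suc N. M ^ (j - 1) * fps_nth (B ^ j) n * r ^ n))"
      unfolding fps_psum_def
    proof (rule sum_mono)
      fix n assume n: "n \<in> {..Suc N}"
      let ?T = "\<lambda>J. \<Sum>j=2..J. M ^ (j - 1) * fps_nth (B ^ j) n * r ^ n"
      have T0: "0 \<le> ?T J" for J
        using M r fps_power_nonneg[OF B_nonneg] by (intro sum_nonneg) auto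
      consider "n = 0" | "n = 1" | "n \<ge> 2" by force
      then show "fps_nth B n * r ^ n \<le> (if n = 1 then r else 0) + ?T (Suc N)"
      proof cases
        case 1
        then show ?thesis using B0 T0[of "Suc N"] by simp
      next
        case 2
        then have "fps_nth B n \<le> 1" using K0[of 0] by (simp add: B_def H)
        then have "fps_nth B n * r \<le> 1 * r" using r by (intro mult_right_mono) auto
        then show ?thesis using T0[of "Suc N"] 2 by simp
      next
        case 3
        have "fps_nth B n * r ^ n \<le> ?T n"
          unfolding sum_distrib_right[symmetric] using r by (intro mult_right_mono B_rec 3) auto
        also have "\<dots> \<le> ?T (Suc N)"
          using n M r fps_power_nonneg[OF B_nonneg] by (intro sum_mono2) auto
        finally show ?thesis using 3 by simp
      qed
    qed
    also have "\<dots> = r + (\<Sum>j=2..Suc N. M ^ (j - 1) * fps_psum r (B ^ j) (Suc N))"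
      unfolding sum.distrib fps_psum_def sum_distrib_left
      by (subst (2) sum.swap) (simp add: mult_ac)
    also have "\<dots> \<le> r + (\<Sum>j=2..Suc N. 2 * r * (1 / 3) ^ (j - 1))"
    proof (intro add_left_mono sum_mono)
      fix j assume j: "j \<in> {2..Suc N}"
      have "fps_psum r (B ^ j) (Suc N) \<le> fps_psum r B N ^ j"
        using j r by (intro fps_psum_power_le_Suc B_nonneg B0) auto
      also have "\<dots> \<le> (2 * r) ^ j"
        using r by (intro power_mono Suc fps_psum_nonneg B_nonneg) auto
      finally have "M ^ (j - 1) * fps_psum r (B ^ j) (Suc N) \<le> M ^ (j - 1) * (2 * r) ^ j"
        using M by (intro mult_left_mono) auto
      also have "\<dots> = 2 * r * (2 * r * M) ^ (j - 1)"
        using j by (cases j) (auto simp: power_mult_distrib)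
      finally show "M ^ (j - 1) * fps_psum r (B ^ j) (Suc N) \<le> 2 * r * (1 / 3) ^ (j - 1)"
        by (simp only: r(2))
    qed
    also have "\<dots> \<le> r + 2 * r * (1 / 2)"
      unfolding sum_distrib_left[symmetric] using r by (intro add_left_mono mult_left_mono geom) auto
    finally show ?case by simp
  qed
  have "fps_nth B n * r ^ n \<le> fps_psum r B n"
    unfolding fps_psum_def using r B_nonneg by (intro member_le_sum) auto
  also have "\<dots> \<le> 2 * r" by (rule S)
  finally have "exp (K (n - 1)) * (fps_nth B n * r ^ n) \<le> exp (K (n - 1)) * (2 * r)"
    by (intro mult_left_mono) auto
  then show ?thesis unfolding H_def[symmetric] HB by (simp add: r_def mult_ac)
qed

text \<open>Convergence at some \<open>s > 0\<close> bounds the coefficients by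
  \<open>c / s ^ j\<close>, that is, \<open>(c / s) * (1 / s) ^ (j - 1)\<close>. Since
  \<open>j \<ge> 2\<close>, a single factor \<open>c / s\<close> can be absorbed into the
  power.\<close>

lemma fps_conv_radius_pos_coeff_bound:
  fixes G :: "complex fps"
  assumes "fps_conv_radius G > 0"
  obtains M where "M > 0" "\<And>j. 2 \<le> j \<Longrightarrow> norm (fps_nth G j) \<le> M ^ (j - 1)"
proof -
  obtain s where s: "0 < s" "ereal s < fps_conv_radius G"
    using ereal_dense2[OF assms] by (auto simp: zero_ereal_def)
  then have "summable (\<lambda>n. fps_nth G n * of_real s ^ n)"
    by (intro summable_fps) auto
  then have "Bseq (\<lambda>n. fps_nth G n * of_real s ^ n)"
    by (intro convergent_imp_Bseq) (use summable_LIMSEQ_zero convergentI in blast)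
  then obtain c where c: "c > 0" "\<And>n. norm (fps_nth G n * of_real s ^ n) \<le> c"
    by (auto elim: BseqE)
  define M where "M = max 1 (c / s) * max 1 (1 / s)"
  have M1: "max 1 (c / s) \<ge> 1" "max 1 (1 / s) \<ge> 1" by auto
  show thesis
  proof (rule that)
    show "M > 0" unfolding M_def using M1 by (intro mult_pos_pos) linarith+
    fix j :: nat assume j: "2 \<le> j"
    then obtain k where k: "j = Suc (Suc k)" by (metis Suc_le_D numeral_2_eq_2 Suc_le_mono)
    have "norm (fps_nth G j) * s ^ j \<le> c" using c(2)[of j] s by (simp add: norm_mult norm_power)
    then have "norm (fps_nth G j) \<le> c / s ^ j" using s by (simp add: field_simps)
    also have "\<dots> = (c / s) ^ 1 * (1 / s) ^ Suc k" using s by (simp add: k power_divide)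
    also have "\<dots> \<le> max 1 (c / s) ^ Suc k * max 1 (1 / s) ^ Suc k"
    proof (rule mult_mono)
      have "(c / s) ^ 1 \<le> max 1 (c / s) ^ 1" by simp
      also have "\<dots> \<le> max 1 (c / s) ^ Suc k" by (rule power_increasing) auto
      finally show "(c / s) ^ 1 \<le> max 1 (c / s) ^ Suc k" .
      show "(1 / s) ^ Suc k \<le> max 1 (1 / s) ^ Suc k" using s by (intro power_mono) auto
    qed (use s in auto)
    finally show "norm (fps_nth G j) \<le> M ^ (j - 1)" by (simp add: k M_def power_mult_distrib mult_ac)
  qed
qed

text \<open>As \<open>K\<close> grows at most linearly, the coefficient bound becomes geometric and
  the formal solution has positive radius of convergence. The identity between formal compositions
  then is an identity of functions near \<open>0\<close>.\<close>

theorem brjuno_linearization: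
  assumes "brjuno \<theta>"
  defines "\<rho> \<equiv> exp (2 * complex_of_real pi * \<i> * complex_of_real \<theta>)"
  assumes g: "g has_fps_expansion G" "fps_nth G 0 = 0" "fps_nth G 1 = \<rho>"
  obtains h r where "r > 0" "h holomorphic_on ball 0 r" "h 0 = 0" "deriv h 0 = 1"
    "\<And>z. z \<in> ball 0 r \<Longrightarrow> g (h z) = h (\<rho> * z)"
proof -
  obtain K C where K: "\<And>n. 0 \<le> K n" "\<And>n. K n \<le> C * real n" "\<And>m n. K m + K n \<le> K (m + n)"
    "\<And>n. exp (K n) \<le> exp (K (Suc n)) * norm (\<rho> ^ Suc n - 1)"
    using brjuno_small_divisors[OF assms(1)] unfolding \<rho>_def by blast
  have \<rho>: "norm \<rho> = 1" by (simp add: \<rho>_def norm_exp_eq_Re)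
  have nonres: "\<forall>n\<ge>2. \<rho> ^ n \<noteq> \<rho>"
  proof (intro allI impI notI)
    fix n :: nat assume that: "n \<ge> 2"
    assume eq: "\<rho> ^ n = \<rho>"
    have n: "n = Suc (Suc (n - 2))" using that by simp
    have "\<rho> * \<rho> ^ Suc (n - 2) = \<rho> * 1" using eq n by (metis mult.right_neutral power_Suc)
    then have "\<rho> ^ Suc (n - 2) = 1" using \<rho> by (metis mult_left_cancel norm_zero zero_neq_one)
    then show False using K(4)[of "n - 2"] by (simp del: power_Suc)
  qed
  obtain M where M: "M > 0" "\<And>j. 2 \<le> j \<Longrightarrow> norm (fps_nth G j) \<le> M ^ (j - 1)"
    using fps_conv_radius_pos_coeff_bound g(1) by (metis has_fps_expansion_def)
  define H where "H = linearizing_fps G \<rho>"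
  note H = linearizing_fps_nth[where \<rho> = \<rho> and G = G, OF nonres, folded H_def]
  have C: "C \<ge> 0" using K(1)[of 1] K(2)[of 1] by simp
  \<comment> \<open>The coefficients are bounded by \<open>(6 * M * exp C) ^ n\<close> up to a
    constant; half the inverse of the base gives a geometric series of ratio
    \<open>1 / 2\<close>.\<close>
  define t where "t = 1 / (12 * M * exp C)"
  have t: "t > 0" using M by (simp add: t_def)
  have "summable (\<lambda>n. fps_nth H n * of_real t ^ n)"
  proof (rule summable_comparison_test')
    show "summable (\<lambda>n. (1 / (3 * M)) * (1 / 2 :: real) ^ n)"
      by (intro summable_mult summable_geometric) simp
    show "norm (fps_nth H n * of_real t ^ n) \<le> (1 / (3 * M)) * (1 / 2) ^ n" for n
    proof -
      have "norm (fps_nth H n) * (1 / (6 * M)) ^ n \<le> (1 / (3 * M)) * exp (K (n - 1))"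
        unfolding H_def by (rule linearizing_fps_bound) (use K M \<rho> in auto)
      also have "\<dots> \<le> (1 / (3 * M)) * exp (C * real n)"
      proof -
        have "K (n - 1) \<le> C * real (n - 1)" by (rule K(2))
        also have "\<dots> \<le> C * real n" using C by (intro mult_left_mono) auto
        finally show ?thesis using M by (intro mult_left_mono) auto
      qed
      finally have "norm (fps_nth H n) * (1 / (6 * M)) ^ n * (1 / (2 * exp C)) ^ n
          \<le> (1 / (3 * M)) * exp (C * real n) * (1 / (2 * exp C)) ^ n"
        by (intro mult_right_mono) auto
      also have "exp (C * real n) = exp C ^ n" by (simp add: exp_of_nat2_mult)
      also have "(1 / (3 * M)) * exp C ^ n * (1 / (2 * exp C)) ^ n = (1 / (3 * M)) * (1 / 2) ^ n"
        by (simp add: power_divide power_mult_distrib)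
      also have "norm (fps_nth H n) * (1 / (6 * M)) ^ n * (1 / (2 * exp C)) ^ n = norm (fps_nth H n * of_real t ^ n)"
      proof -
        have "t = (1 / (6 * M)) * (1 / (2 * exp C))" by (simp add: t_def)
        then have "t ^ n = (1 / (6 * M)) ^ n * (1 / (2 * exp C)) ^ n" by (simp only: power_mult_distrib)
        then show ?thesis using t by (simp add: norm_mult norm_power)
      qed
      finally show ?thesis .
    qed
  qed
  then have "ereal (norm (complex_of_real t)) \<le> fps_conv_radius H"
    unfolding fps_conv_radius_def by (rule conv_radius_geI)
  then have rad: "ereal t \<le> fps_conv_radius H" using t by simp
  then have rad0: "fps_conv_radius H > 0" using t by (metis ereal_less(2) less_le_trans)
  then have h: "eval_fps H has_fps_expansion H" by (rule eval_fps_has_fps_expansion)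
  have 1: "(g \<circ> eval_fps H) has_fps_expansion fps_compose G H"
    by (rule has_fps_expansion_compose[OF g(1) h]) (simp add: H)
  have "(\<lambda>z. \<rho> * z) has_fps_expansion fps_const \<rho> * fps_X"
    by (intro fps_expansion_intros)
  then have 2: "(eval_fps H \<circ> (\<lambda>z. \<rho> * z)) has_fps_expansion fps_compose H (fps_const \<rho> * fps_X)"
    by (intro has_fps_expansion_compose[OF h]) auto
  have "fps_compose G H = fps_compose H (fps_const \<rho> * fps_X)"
    unfolding H_def using nonres g by (intro linearizing_fps_compose) auto
  with 1 2 have "\<forall>\<^sub>F z in nhds 0. (g \<circ> eval_fps H) z = (eval_fps H \<circ> (\<lambda>z. \<rho> * z)) z"
    unfolding has_fps_expansion_def by (auto elim: eventually_elim2)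
  then obtain e where e: "e > 0" "\<And>z. z \<in> ball 0 e \<Longrightarrow> g (eval_fps H z) = eval_fps H (\<rho> * z)"
    unfolding eventually_nhds_metric by (auto simp: dist_commute)
  show thesis
  proof (rule that)
    show "min e t > 0" using e t by simp
    have "ball 0 (min e t) \<subseteq> eball 0 (fps_conv_radius H)"
      using ball_eball_mono[OF rad] subset_ball[of "min e t" t 0] by (meson order_trans min.cobounded2)
    then show "eval_fps H holomorphic_on ball 0 (min e t)" by (intro holomorphic_on_eval_fps)
    show "eval_fps H 0 = 0" by (simp add: eval_fps_at_0 H)
    have "(eval_fps H has_field_derivative eval_fps (fps_deriv H) 0) (at 0)"
      using rad0 by (intro has_field_derivative_eval_fps) (auto simp: zero_ereal_def)
    then show "deriv (eval_fps H) 0 = 1" by (simp add: DERIV_imp_deriv eval_fps_at_0 H)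
  qed (use e in auto)
qed

section \<open>Siegel disks\<close>

text \<open>A local bound on all iterates is easier to propagate than normality: the maximum
  principle carries it from a curve to the region inside.\<close>

definition stable_set :: "(complex \<Rightarrow> complex) \<Rightarrow> complex set" where
  "stable_set f = {z. \<exists>D M. open D \<and> z \<in> D \<and> (\<forall>n. \<forall>w\<in>D. norm ((f ^^ n) w) \<le> M)}"

lemma stable_setI:
  assumes "open D" "z \<in> D" "\<And>n w. w \<in> D \<Longrightarrow> norm ((f ^^ n) w) \<le> M"
  shows "z \<in> stable_set f"
  using assms unfolding stable_set_def by blast

lemma open_stable_set: "open (stable_set f)"
proof (subst open_subopen, rule ballI)
  fix z assume "z \<in> stable_set f"
  then obtain D M where D: "open D" "z \<in> D" "\<And>n w. w \<in> D \<Longrightarrow> norm ((f ^^ n) w) \<le> M"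
    unfolding stable_set_def by blast
  moreover have "D \<subseteq> stable_set f" using D by (blast intro: stable_setI)
  ultimately show "\<exists>T. open T \<and> z \<in> T \<and> T \<subseteq> stable_set f" by blast
qed

lemma stable_set_compact:
  assumes "compact K" "K \<subseteq> stable_set f"
  obtains M where "\<And>n w. w \<in> K \<Longrightarrow> norm ((f ^^ n) w) \<le> M"
proof -
  have "\<forall>z\<in>K. \<exists>D M. open D \<and> z \<in> D \<and> (\<forall>n. \<forall>w\<in>D. norm ((f ^^ n) w) \<le> M)"
    using assms(2) unfolding stable_set_def by blast
  then obtain D M where D: "\<And>z. z \<in> K \<Longrightarrow> open (D z)" "\<And>z. z \<in> K \<Longrightarrow> z \<in> D z"
    "\<And>z n w. z \<in> K \<Longrightarrow> w \<in> D z \<Longrightarrow> norm ((f ^^ n) w) \<le> M z" by metis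
  obtain C where C: "C \<subseteq> K" "finite C" "K \<subseteq> (\<Union>c\<in>C. D c)"
    by (rule compactE_image[OF assms(1), of K D]) (use D in auto)
  show thesis
  proof (rule that)
    fix n w assume "w \<in> K"
    then obtain c where c: "c \<in> C" "w \<in> D c" using C by blast
    then have "norm ((f ^^ n) w) \<le> M c" using D C by blast
    also have "\<dots> \<le> Max (M ` C)" using c C by simp
    finally show "norm ((f ^^ n) w) \<le> Max (M ` C)" .
  qed
qed

section \<open>Stable points and Fatou components\<close>

lemma holomorphic_funpow:
  assumes "f holomorphic_on UNIV"
  shows "(f ^^ n) holomorphic_on UNIV"
proof (induction n)
  case (Suc n)
  then show ?case unfolding funpow.simps
    by (rule holomorphic_on_compose) (rule holomorphic_on_subset[OF assms subset_UNIV])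
qed (simp add: id_def)

lemma stable_set_subset_fatou_set:
  assumes "f holomorphic_on UNIV"
  shows "stable_set f \<subseteq> fatou_set f"
proof
  fix z assume "z \<in> stable_set f"
  then obtain D M where D: "open D" "z \<in> D" "\<And>n w. w \<in> D \<Longrightarrow> norm ((f ^^ n) w) \<le> M"
    unfolding stable_set_def by blast
  then obtain e where e: "e > 0" "ball z e \<subseteq> D" using openE by blast
  have "normal_family (range (\<lambda>n. f ^^ n)) (ball z e)"
    unfolding normal_family_def
  proof (intro allI impI)
    fix s :: "nat \<Rightarrow> complex \<Rightarrow> complex" assume s: "range s \<subseteq> range (\<lambda>n. f ^^ n)"
    obtain g r where "g holomorphic_on ball z e" "strict_mono (r :: nat \<Rightarrow> nat)"
      "\<And>K. compact K \<Longrightarrow> K \<subseteq> ball z e \<Longrightarrow> uniform_limit K (s \<circ> r) g sequentially"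
    proof (rule Montel[OF open_ball _ _ s])
      show "h holomorphic_on ball z e" if "h \<in> range (\<lambda>n. f ^^ n)" for h
        using that holomorphic_funpow[OF assms] holomorphic_on_subset by blast
      show "\<exists>B. \<forall>h\<in>range (\<lambda>n. f ^^ n). \<forall>z\<in>K. norm (h z) \<le> B" if "K \<subseteq> ball z e" for K
        using D(3) that e(2) by blast
    qed blast
    then show "\<exists>r :: nat \<Rightarrow> nat. strict_mono r \<and>
         ((\<exists>g. g holomorphic_on ball z e \<and>
              (\<forall>K. compact K \<and> K \<subseteq> ball z e \<longrightarrow> uniform_limit K (s \<circ> r) g sequentially)) \<or>
          (\<forall>K. compact K \<and> K \<subseteq> ball z e \<longrightarrow>
              (\<forall>B. \<forall>\<^sub>F n in sequentially. \<forall>z\<in>K. B < norm (s (r n) z))))"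
      by blast
  qed
  moreover have "z \<in> ball z e" "open (ball z e)" "connected (ball z e)" using e by auto
  ultimately show "z \<in> fatou_set f" unfolding fatou_set_def by blast
qed

text \<open>If the iterates were unbounded on a closed ball in \<open>D\<close>, some sequence of
  them would exceed \<open>k\<close> at its \<open>k\<close>-th term somewhere in the ball. No
  subsequence has a finite limit uniformly there, and none tends to infinity on \<open>D\<close>,
  because the orbit of \<open>x\<close> is bounded.\<close>

lemma normal_domain_subset_stable_set:
  assumes D: "open D" "normal_family (range (\<lambda>n. f ^^ n)) D"
    and x: "x \<in> D" "x \<in> stable_set f"
  shows "D \<subseteq> stable_set f"
proof
  fix y assume "y \<in> D"
  then obtain e where e: "e > 0" "cball y e \<subseteq> D" using D(1) open_contains_cball by blast
  have "\<exists>M. \<forall>n. \<forall>w\<in>cball y e. norm ((f ^^ n) w) \<le> M"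
  proof (rule ccontr)
    assume "\<nexists>M. \<forall>n. \<forall>w\<in>cball y e. norm ((f ^^ n) w) \<le> M"
    then have "\<forall>k::nat. \<exists>n w. w \<in> cball y e \<and> real k < norm ((f ^^ n) w)"
      by (meson not_le)
    then obtain m w where mw: "\<And>k::nat. w k \<in> cball y e" "\<And>k. real k < norm ((f ^^ (m k)) (w k))"
      by metis
    define s where "s = (\<lambda>k. f ^^ (m k))"
    have "range s \<subseteq> range (\<lambda>n. f ^^ n)" by (auto simp: s_def)
    then obtain r :: "nat \<Rightarrow> nat" where r: "strict_mono r" and
      alt: "(\<exists>g. g holomorphic_on D \<and> (\<forall>K. compact K \<and> K \<subseteq> D \<longrightarrow> uniform_limit K (s \<circ> r) g sequentially)) \<or>
        (\<forall>K. compact K \<and> K \<subseteq> D \<longrightarrow> (\<forall>B. \<forall>\<^sub>F n in sequentially. \<forall>z\<in>K. B < norm (s (r n) z)))"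
      using D(2) unfolding normal_family_def by blast
    from alt show False
    proof (elim disjE exE conjE)
      fix g assume g: "g holomorphic_on D"
        and lim: "\<forall>K. compact K \<and> K \<subseteq> D \<longrightarrow> uniform_limit K (s \<circ> r) g sequentially"
      have "compact (g ` cball y e)"
        by (intro compact_continuous_image compact_cball
            continuous_on_subset[OF holomorphic_on_imp_continuous_on[OF g] e(2)])
      then obtain B where B: "\<And>z. z \<in> cball y e \<Longrightarrow> norm (g z) \<le> B"
        using compact_imp_bounded bounded_iff by (metis image_eqI)
      have "\<forall>\<^sub>F n in sequentially. \<forall>z\<in>cball y e. dist ((s \<circ> r) n z) (g z) < 1"
        using lim e unfolding uniform_limit_iff by (simp add: compact_cball)
      then obtain N where N: "\<And>n z. n \<ge> N \<Longrightarrow> z \<in> cball y e \<Longrightarrow> dist (s (r n) z) (g z) < 1"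
        unfolding eventually_sequentially comp_def by blast
      define n where "n = max N (nat \<lceil>B + 1\<rceil>)"
      have n: "n \<ge> N" "real n \<ge> B + 1"
        using real_nat_ceiling_ge[of "B + 1"] by (simp_all add: n_def)
      have "norm (s (r n) (w (r n))) \<le> norm (g (w (r n))) + dist (s (r n) (w (r n))) (g (w (r n)))"
        by (metis dist_norm norm_triangle_sub)
      also have "\<dots> \<le> B + 1" using B[OF mw(1)[of "r n"]] N[OF n(1) mw(1)[of "r n"]] by linarith
      also have "\<dots> \<le> real (r n)" using n seq_suble[OF r, of n] by linarith
      also have "\<dots> < norm (s (r n) (w (r n)))" unfolding s_def by (rule mw(2))
      finally show False by simp
    next
      assume inf: "\<forall>K. compact K \<and> K \<subseteq> D \<longrightarrow> (\<forall>B. \<forall>\<^sub>F n in sequentially. \<forall>z\<in>K. B < norm (s (r n) z))"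
      obtain M where M: "\<And>n. norm ((f ^^ n) x) \<le> M" using x(2) unfolding stable_set_def by blast
      have "compact {x} \<and> {x} \<subseteq> D" using x(1) by simp
      then have "\<forall>\<^sub>F n in sequentially. \<forall>z\<in>{x}. M < norm (s (r n) z)"
        using inf by blast
      then obtain n where "M < norm (s (r n) x)" unfolding eventually_sequentially by auto
      then show False using M[of "m (r n)"] by (simp add: s_def)
    qed
  qed
  then obtain M where M: "\<And>n w. w \<in> cball y e \<Longrightarrow> norm ((f ^^ n) w) \<le> M" by blast
  show "y \<in> stable_set f"
    by (rule stable_setI[of "ball y e" _ _ M]) (use M e in auto)
qed

text \<open>Each domain of normality lies in the stable set or misses it. The stable set and the
  union \<open>R\<close> of those that miss it thus separate \<open>U\<close> into disjoint open
  parts, one of which is empty.\<close>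

lemma fatou_component_subset_stable_set:
  assumes U: "U \<in> components (fatou_set f)" and x: "x \<in> U" "x \<in> stable_set f"
  shows "U \<subseteq> stable_set f"
proof -
  define R where "R = \<Union>{D. open D \<and> normal_family (range (\<lambda>n. f ^^ n)) D \<and> D \<inter> stable_set f = {}}"
  have "U \<subseteq> stable_set f \<union> R"
  proof
    fix z assume "z \<in> U"
    then have "z \<in> fatou_set f" using U in_components_subset by blast
    then obtain D where D: "open D" "z \<in> D" "normal_family (range (\<lambda>n. f ^^ n)) D"
      unfolding fatou_set_def by blast
    show "z \<in> stable_set f \<union> R"
    proof (cases "D \<inter> stable_set f = {}")
      case True
      then show ?thesis using D unfolding R_def by blast
    next
      case False
      then show ?thesis using normal_domain_subset_stable_set D by blast
    qed
  qed
  moreover have "open R" "stable_set f \<inter> R \<inter> U = {}" unfolding R_def by auto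
  ultimately have "stable_set f \<inter> U = {} \<or> R \<inter> U = {}"
    using connectedD[OF in_components_connected[OF U] open_stable_set] by blast
  then show ?thesis using x \<open>U \<subseteq> stable_set f \<union> R\<close> by blast
qed

lemma open_fatou_set: "open (fatou_set f)"
proof (subst open_subopen, rule ballI)
  fix z assume "z \<in> fatou_set f"
  then obtain D where "open D" "connected D" "z \<in> D" "normal_family (range (\<lambda>n. f ^^ n)) D"
    unfolding fatou_set_def by blast
  moreover from this have "D \<subseteq> fatou_set f" unfolding fatou_set_def by blast
  ultimately show "\<exists>T. open T \<and> z \<in> T \<and> T \<subseteq> fatou_set f" by blast
qed

lemma stable_set_image:
  assumes "f holomorphic_on UNIV" "\<not> f constant_on UNIV"
  shows "f ` stable_set f \<subseteq> stable_set f"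
proof clarify
  fix z assume "z \<in> stable_set f"
  then obtain D M where D: "open D" "z \<in> D" "\<And>n w. w \<in> D \<Longrightarrow> norm ((f ^^ n) w) \<le> M"
    unfolding stable_set_def by blast
  have "open (f ` D)"
    by (rule open_mapping_thm[OF assms(1) open_UNIV connected_UNIV D(1) _ assms(2)]) simp
  moreover have "norm ((f ^^ n) w) \<le> M" if "w \<in> f ` D" for n w
    using that D(3)[of _ "Suc n"] by (auto simp: funpow_swap1)
  ultimately show "f z \<in> stable_set f" using D(2) by (blast intro: stable_setI)
qed

text \<open>If a loop in \<open>U\<close> winds around a point outside \<open>U\<close>, that point
  lies in a bounded component \<open>W\<close> of the complement of the loop. The iterates are
  bounded on the loop, hence on \<open>W\<close> by the maximum principle, so the closure of
  \<open>W\<close> is connected, lies in the Fatou set and meets \<open>U\<close>; it is contained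
  in \<open>U\<close>, a contradiction.\<close>

lemma simply_connected_stable_component:
  assumes f: "f holomorphic_on UNIV"
    and U: "U \<in> components (fatou_set f)" "U \<subseteq> stable_set f"
  shows "simply_connected U"
proof -
  have "open U" using U(1) open_fatou_set open_components by blast
  moreover have "winding_number g z = 0"
    if g: "path g" "path_image g \<subseteq> U" "pathfinish g = pathstart g" and z: "z \<notin> U" for g z
  proof (rule ccontr)
    assume "winding_number g z \<noteq> 0"
    then have "z \<notin> outside (path_image g)" using winding_number_zero_in_outside g by blast
    moreover have zP: "z \<notin> path_image g" using g z by blast
    ultimately have zi: "z \<in> inside (path_image g)" using inside_Un_outside by blast
    define W where "W = connected_component_set (- path_image g) z"
    have W: "bounded W" "z \<in> W" "connected W" "open W"
      using zi zP compact_path_image[OF g(1)]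
      by (auto simp: W_def inside_def open_Compl compact_imp_closed open_connected_component)
    have "frontier W \<subseteq> frontier (- path_image g)"
      unfolding W_def by (rule frontier_of_connected_component_subset)
    also have "\<dots> \<subseteq> path_image g"
      using compact_imp_closed[OF compact_path_image[OF g(1)]] frontier_subset_closed
      by (simp add: frontier_complement)
    finally have fr: "frontier W \<subseteq> path_image g" .
    obtain M where M: "\<And>n w. w \<in> path_image g \<Longrightarrow> norm ((f ^^ n) w) \<le> M"
      using stable_set_compact[OF compact_path_image[OF g(1)], of f] g(2) U(2) by blast
    have "norm ((f ^^ n) w) \<le> M" if "w \<in> W" for n w
    proof (rule maximum_modulus_frontier[of "f ^^ n" W])
      show "(f ^^ n) holomorphic_on interior W" "continuous_on (closure W) (f ^^ n)"
        using holomorphic_funpow[OF f] holomorphic_on_subset holomorphic_on_imp_continuous_on by blast+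
    qed (use W fr M that in auto)
    then have "W \<subseteq> stable_set f" using W by (blast intro: stable_setI)
    then have "closure W \<subseteq> fatou_set f"
      using fr g(2) U(2) stable_set_subset_fatou_set[OF f] closure_Un_frontier[of W] by blast
    moreover have "frontier W \<noteq> {}"
      using W frontier_eq_empty[of W] not_bounded_UNIV by blast
    then have "U \<inter> closure W \<noteq> {}" using fr g(2) closure_Un_frontier[of W] by blast
    ultimately have "closure W \<subseteq> U"
      using components_maximal[OF U(1) connected_imp_connected_closure[OF W(3)]] by blast
    then show False using z W closure_subset by blast
  qed
  ultimately show ?thesis
    using simply_connected_eq_winding_number_zero in_components_connected[OF U(1)] by blast
qed

text \<open>A Riemann map followed by a disk automorphism sends \<open>a\<close> to
  \<open>0\<close>. The conjugated map \<open>L\<close> has the same derivative at its fixed point,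
  of modulus \<open>1\<close>, so the equality case of Schwarz's lemma makes it linear.\<close>

lemma conj_to_rotation_fixed_point:
  fixes \<theta> :: real
  assumes h: "h holomorphic_on U" "h ` U \<subseteq> U"
    and U: "open U" "simply_connected U" "U \<noteq> UNIV"
    and a: "a \<in> U" "h a = a" "deriv h a = exp (2 * complex_of_real pi * \<i> * complex_of_real \<theta>)"
  shows "conj_to_rotation h U \<theta>"
proof -
  let ?\<rho> = "exp (2 * complex_of_real pi * \<i> * complex_of_real \<theta>)"
  obtain \<phi> \<psi> where \<phi>: "\<phi> holomorphic_on U" "\<psi> holomorphic_on ball 0 1"
    "\<And>z. z \<in> U \<Longrightarrow> \<phi> z \<in> ball 0 1 \<and> \<psi> (\<phi> z) = z" "\<And>z. z \<in> ball 0 1 \<Longrightarrow> \<psi> z \<in> U \<and> \<phi> (\<psi> z) = z"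
  proof -
    have "U \<noteq> {}" using a by blast
    then show ?thesis using Riemann_mapping_theorem[of U] U that by blast
  qed
  obtain \<mu> \<nu> where \<mu>: "\<mu> (\<phi> a) = 0" "\<mu> holomorphic_on ball 0 1" "\<mu> ` ball 0 1 \<subseteq> ball 0 1"
    "\<nu> holomorphic_on ball 0 1" "\<nu> ` ball 0 1 \<subseteq> ball 0 1"
    "\<And>z. z \<in> ball 0 1 \<Longrightarrow> \<mu> (\<nu> z) = z" "\<And>z. z \<in> ball 0 1 \<Longrightarrow> \<nu> (\<mu> z) = z"
    using ball_biholomorphism_exists \<phi>(3)[OF a(1)] by blast
  define F where "F = \<mu> \<circ> \<phi>"
  define G where "G = \<psi> \<circ> \<nu>"
  have F: "F holomorphic_on U" unfolding F_def
    using \<phi>(1,3) \<mu>(2) by (intro holomorphic_on_compose_gen[of _ _ _ "ball 0 1"]) auto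
  have G: "G holomorphic_on ball 0 1" unfolding G_def
    using \<phi>(2) \<mu>(4,5) by (intro holomorphic_on_compose_gen[of _ _ _ "ball 0 1"]) auto
  have FU: "F z \<in> ball 0 1" "G (F z) = z" if "z \<in> U" for z
    using \<phi>(3)[OF that] \<mu>(3,7) by (simp_all add: F_def G_def image_subset_iff)
  have GB: "G z \<in> U" "F (G z) = z" if "z \<in> ball 0 1" for z
    using \<phi>(4)[of "\<nu> z"] \<mu>(5,6) that by (simp_all add: F_def G_def image_subset_iff)
  have Fa: "F a = 0" by (simp add: F_def \<mu>)
  then have G0: "G 0 = a" using FU(2)[OF a(1)] by simp
  define L where "L = (F \<circ> h) \<circ> G"
  have Fh: "(F \<circ> h) holomorphic_on U"
    by (rule holomorphic_on_compose_gen[OF h(1) F h(2)])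
  have L: "L holomorphic_on ball 0 1" unfolding L_def
    using GB by (intro holomorphic_on_compose_gen[OF G Fh]) auto
  have L0: "L 0 = 0" by (simp add: L_def G0 a Fa)
  have L1: "norm (L z) < 1" if "norm z < 1" for z
    using FU(1)[of "h (G z)"] GB(1)[of z] h(2) that by (auto simp: L_def)
  have dF: "(F has_field_derivative deriv F a) (at a)"
    using F U a by (simp add: holomorphic_derivI)
  have dG: "(G has_field_derivative deriv G 0) (at 0)"
    using G by (simp add: holomorphic_derivI[of _ "ball 0 1"])
  have dh: "(h has_field_derivative ?\<rho>) (at a)"
    using holomorphic_derivI[OF h(1) U(1) a(1)] a by simp
  have "(F \<circ> G has_field_derivative deriv F a * deriv G 0) (at 0)"
    using dF dG G0 by (intro DERIV_chain) auto
  moreover have "((\<lambda>z. z) has_field_derivative 1) (at (0::complex))" by simp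
  then have "(F \<circ> G has_field_derivative 1) (at 0)"
    by (rule has_field_derivative_transform_within_open[of _ _ _ "ball 0 1"]) (use GB in auto)
  ultimately have one: "deriv F a * deriv G 0 = 1" using DERIV_unique by blast
  have "(F \<circ> h has_field_derivative deriv F a * ?\<rho>) (at a)"
    using dF dh a by (intro DERIV_chain) auto
  then have "(L has_field_derivative deriv F a * ?\<rho> * deriv G 0) (at 0)"
    unfolding L_def by (intro DERIV_chain[OF _ dG]) (simp add: G0)
  then have "(L has_field_derivative ?\<rho>) (at 0)" using one by (metis mult.assoc mult.commute mult.right_neutral)
  then have dL: "deriv L 0 = ?\<rho>" by (rule DERIV_imp_deriv)
  have "norm (deriv L 0) = 1" unfolding dL by (simp add: norm_exp_eq_Re)
  then obtain \<alpha> where \<alpha>: "\<And>z. norm z < 1 \<Longrightarrow> L z = \<alpha> * z"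
    using Schwarz_Lemma(3)[OF L L0 L1, of 0] by auto
  have "((\<lambda>z. \<alpha> * z) has_field_derivative \<alpha>) (at 0)"
    by (auto intro!: derivative_eq_intros)
  then have "(L has_field_derivative \<alpha>) (at 0)"
    by (rule has_field_derivative_transform_within_open[of _ _ _ "ball 0 1"]) (use \<alpha> in auto)
  then have \<alpha>_eq: "\<alpha> = ?\<rho>" using dL DERIV_imp_deriv by blast
  have "F (h z) = ?\<rho> * F z" if "z \<in> U" for z
    using \<alpha>[of "F z"] FU[OF that] by (simp add: L_def \<alpha>_eq)
  moreover have bij: "bij_betw F U (ball 0 1)"
    by (rule bij_betw_byWitness[of _ G]) (use FU GB in auto)
  moreover have "inv_into U F holomorphic_on ball 0 1"
  proof (rule holomorphic_transform[OF G])
    fix z :: complex assume "z \<in> ball 0 1"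
    then show "G z = inv_into U F z"
      using GB[of z] bij_betw_imp_inj_on[OF bij] by (metis inv_into_f_f)
  qed
  ultimately show ?thesis
    unfolding conj_to_rotation_def conformal_iso_def using h(2) F by blast
qed

text \<open>If every point were stable, Montel's theorem would give an entire limit of a subsequence
  of the iterates of orders \<open>n * p\<close>. It vanishes near the attracting point
  \<open>0\<close>, hence everywhere, but it takes the value \<open>a\<close> at the periodic point
  \<open>a\<close>.\<close>

lemma stable_set_neq_UNIV:
  assumes f: "f holomorphic_on UNIV"
    and r: "r > 0" "\<And>z. norm z < r \<Longrightarrow> norm (f z) \<le> norm z / 2"
    and per: "(f ^^ p) a = a" "p \<ge> 1" "a \<noteq> 0"
  shows "stable_set f \<noteq> UNIV"
proof
  assume UNIV: "stable_set f = UNIV"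
  define s where "s = (\<lambda>n. f ^^ (n * p))"
  obtain g k where g: "g holomorphic_on UNIV" "strict_mono (k :: nat \<Rightarrow> nat)"
    "\<And>x. (\<lambda>n. s (k n) x) \<longlonglongrightarrow> g x"
  proof (rule Montel[of UNIV "range (\<lambda>n. f ^^ n)" s])
    show "\<exists>B. \<forall>h\<in>range (\<lambda>n. f ^^ n). \<forall>z\<in>K. norm (h z) \<le> B" if K: "compact K" for K
    proof -
      obtain M where "\<And>n w. w \<in> K \<Longrightarrow> norm ((f ^^ n) w) \<le> M"
        using stable_set_compact[OF K, of f] UNIV by blast
      then show ?thesis by blast
    qed
  qed (use holomorphic_funpow[OF f] in \<open>auto simp: s_def\<close>)
  have contr: "norm ((f ^^ n) z) \<le> norm z * (1 / 2) ^ n" if "norm z < r" for n z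
  proof (induction n)
    case (Suc n)
    have "norm z * (1 / 2) ^ n \<le> norm z * 1" by (intro mult_left_mono power_le_one) auto
    then have "norm ((f ^^ n) z) < r" using Suc that by simp
    then show ?case using r(2)[of "(f ^^ n) z"] Suc by simp
  qed simp
  have g0: "g z = 0" if "norm z < r" for z
  proof (rule LIMSEQ_unique[OF g(3)])
    show "(\<lambda>n. s (k n) z) \<longlonglongrightarrow> 0"
    proof (rule Lim_null_comparison)
      show "\<forall>\<^sub>F n in sequentially. norm (s (k n) z) \<le> norm z * (1 / 2) ^ n"
      proof (rule always_eventually, rule allI)
        fix n
        have "n * 1 \<le> k n * p" using seq_suble[OF g(2)] per(2) by (intro mult_mono) auto
        then have "norm z * (1 / 2) ^ (k n * p) \<le> norm z * (1 / 2) ^ n"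
          by (intro mult_left_mono power_decreasing) auto
        then show "norm (s (k n) z) \<le> norm z * (1 / 2) ^ n"
          using contr[OF that, of "k n * p"] by (simp add: s_def)
      qed
      have "(\<lambda>n. (1 / 2 :: real) ^ n) \<longlonglongrightarrow> 0" by (rule LIMSEQ_realpow_zero) auto
      then show "(\<lambda>n. norm z * (1 / 2) ^ n) \<longlonglongrightarrow> 0" by (rule tendsto_mult_right_zero)
    qed
  qed
  have "g a = 0"
    by (rule analytic_continuation_open[of "ball 0 r" UNIV g "\<lambda>_. 0"]) (use r g g0 in auto)
  moreover have "s n a = a" for n
    using per(1) by (induction n) (simp_all add: s_def funpow_add)
  then have "(\<lambda>n. s (k n) a) \<longlonglongrightarrow> a" by simp
  then have "g a = a" using g(3)[of a] LIMSEQ_unique by blast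
  ultimately show False using per(3) by simp
qed

text \<open>In the linearizing coordinate the return map is a rotation and preserves disks, so its
  iterates are bounded near \<open>a\<close>. The remaining fewer than \<open>p\<close> steps are
  bounded on a compact ball.\<close>

lemma periodic_point_stable:
  assumes "brjuno \<theta>"
    and f: "f holomorphic_on UNIV"
    and per: "(f ^^ p) a = a" "p \<ge> 1"
      "deriv (f ^^ p) a = exp (2 * complex_of_real pi * \<i> * complex_of_real \<theta>)"
  shows "a \<in> stable_set f"
proof -
  define \<rho> where "\<rho> = exp (2 * complex_of_real pi * \<i> * complex_of_real \<theta>)"
  have \<rho>: "norm \<rho> = 1" by (simp add: \<rho>_def norm_exp_eq_Re)
  define h where "h = f ^^ p"
  have h: "h holomorphic_on UNIV" unfolding h_def by (rule holomorphic_funpow[OF f])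
  define g where "g = (\<lambda>w. h (a + w) - a)"
  have g: "g holomorphic_on UNIV" unfolding g_def
    by (intro holomorphic_intros holomorphic_on_compose_gen[of "\<lambda>w. a + w" UNIV h UNIV, unfolded o_def] h) auto
  have "(h has_field_derivative \<rho>) (at (a + 0))"
    using holomorphic_derivI[OF h open_UNIV, of a] per(3) by (simp add: h_def \<rho>_def)
  then have "((\<lambda>w. h (a + w)) has_field_derivative \<rho>) (at 0)"
    using DERIV_shift[of h \<rho> 0 a] by (simp add: add.commute)
  then have "(g has_field_derivative \<rho>) (at 0)" unfolding g_def
    by (auto intro!: derivative_eq_intros)
  then have dg: "deriv g 0 = \<rho>" by (rule DERIV_imp_deriv)
  obtain G where G: "g has_fps_expansion G"
    using analytic_at_imp_has_fps_expansion[of g 0] g by (auto simp: analytic_on_holomorphic)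
  have G01: "fps_nth G 0 = 0" "fps_nth G 1 = \<rho>"
    using fps_nth_fps_expansion[OF G, of 0] fps_nth_fps_expansion[OF G, of 1] dg per(1)
    by (simp_all add: g_def h_def)
  obtain H r where H: "r > 0" "H holomorphic_on ball 0 r" "H 0 = 0" "deriv H 0 = 1"
    "\<And>z. z \<in> ball 0 r \<Longrightarrow> g (H z) = H (\<rho> * z)"
    by (rule brjuno_linearization[OF assms(1) G, folded \<rho>_def, OF G01]) (rule that)
  \<comment> \<open>Half of the radius is taken so that the closed disk is compact inside the domain
    of \<open>H\<close>.\<close>
  define D where "D = (\<lambda>w. a + w) ` H ` ball 0 (r / 2)"
  have "\<not> H constant_on ball 0 r"
  proof
    assume "H constant_on ball 0 r"
    then obtain c where c: "\<And>z. z \<in> ball 0 r \<Longrightarrow> H z = c" unfolding constant_on_def by blast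
    have "((\<lambda>_. c) has_field_derivative 0) (at 0)" by simp
    then have "(H has_field_derivative 0) (at 0)"
      by (rule has_field_derivative_transform_within_open[of _ _ _ "ball 0 r"]) (use c H in auto)
    then show False using H(4) DERIV_imp_deriv by fastforce
  qed
  then have "open (H ` ball 0 (r / 2))"
    using H(1) by (intro open_mapping_thm[OF H(2)]) auto
  then have "open D" unfolding D_def by (rule open_translation)
  have "0 \<in> H ` ball 0 (r / 2)" using H(1,3) by (intro image_eqI[of _ _ 0]) auto
  then have "a \<in> D" unfolding D_def by force
  have "compact (H ` cball 0 (r / 2))"
    using H(1) by (intro compact_continuous_image compact_cball
        continuous_on_subset[OF holomorphic_on_imp_continuous_on[OF H(2)]]) auto
  then obtain M where M: "\<And>z. z \<in> cball 0 (r / 2) \<Longrightarrow> norm (H z) \<le> M"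
    using compact_imp_bounded bounded_iff by (metis image_eqI)
  have h_iter: "norm ((h ^^ n) w) \<le> norm a + M" if "w \<in> D" for n w
  proof -
    obtain z where z: "z \<in> ball 0 (r / 2)" "w = a + H z" using \<open>w \<in> D\<close> unfolding D_def by blast
    have rot: "\<rho> ^ n * z \<in> ball 0 (r / 2)" for n using z \<rho> by (simp add: norm_mult norm_power)
    have "(h ^^ n) w = a + H (\<rho> ^ n * z)"
    proof (induction n)
      case (Suc n)
      have "\<rho> ^ n * z \<in> ball 0 r" using rot[of n] H(1) by auto
      from H(5)[OF this] have "h (a + H (\<rho> ^ n * z)) = a + H (\<rho> * (\<rho> ^ n * z))"
        by (simp add: g_def algebra_simps)
      then show ?case using Suc by (simp add: mult_ac)
    qed (simp add: z)
    also have "norm \<dots> \<le> norm a + norm (H (\<rho> ^ n * z))" by (rule norm_triangle_ineq)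
    also have "\<dots> \<le> norm a + M" using M[of "\<rho> ^ n * z"] rot[of n] by simp
    finally show ?thesis .
  qed
  have "\<exists>B. \<forall>w\<in>cball 0 (norm a + M). norm ((f ^^ i) w) \<le> B" for i
  proof -
    have "compact ((f ^^ i) ` cball 0 (norm a + M))"
      by (intro compact_continuous_image compact_cball
          continuous_on_subset[OF holomorphic_on_imp_continuous_on[OF holomorphic_funpow[OF f]]]) auto
    then show ?thesis using compact_imp_bounded bounded_iff by (metis image_eqI)
  qed
  then obtain B where B: "\<And>i w. w \<in> cball 0 (norm a + M) \<Longrightarrow> norm ((f ^^ i) w) \<le> B i" by metis
  show ?thesis
  proof (rule stable_setI[OF \<open>open D\<close> \<open>a \<in> D\<close>])
    fix n w assume w: "w \<in> D"
    have "f ^^ n = f ^^ (n mod p + p * (n div p))" by simp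
    also have "\<dots> = (f ^^ (n mod p)) \<circ> (h ^^ (n div p))"
      by (simp only: funpow_add h_def funpow_mult)
    finally have "norm ((f ^^ n) w) \<le> B (n mod p)" using B h_iter[OF w] by simp
    also have "\<dots> \<le> Max (B ` {..<p})" using per(2) by (intro Max_ge) auto
    finally show "norm ((f ^^ n) w) \<le> Max (B ` {..<p})" .
  qed
qed

text \<open>The cycle consists of the Fatou components of the orbit points. They are distinct
  because a rotation with \<rho> different from \<open>1\<close> fixes only the centre, so each
  component contains only one fixed point of the return map.\<close>

lemma siegel_cycle_exists:
  assumes brj: "brjuno \<theta>"
    and f: "f holomorphic_on UNIV" "\<not> f constant_on UNIV"
    and r: "r > 0" "\<And>z. norm z < r \<Longrightarrow> norm (f z) \<le> norm z / 2"
    and per: "(f ^^ p) a = a" "p \<ge> 1" "a \<noteq> 0" "inj_on (\<lambda>i. (f ^^ i) a) {..<p}"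
      "deriv (f ^^ p) a = exp (2 * complex_of_real pi * \<i> * complex_of_real \<theta>)"
  shows "\<exists>U. siegel_cycle f p \<theta> U"
proof -
  define \<rho> where "\<rho> = exp (2 * complex_of_real pi * \<i> * complex_of_real \<theta>)"
  have \<rho>1: "\<rho> \<noteq> 1"
  proof
    assume "\<rho> = 1"
    then obtain n :: int where "2 * pi * \<theta> = of_int (2 * n) * pi"
      unfolding \<rho>_def exp_eq_1 by auto
    then have "\<theta> = of_int n" by simp
    then show False using brj by (simp add: brjuno_def)
  qed
  define b where "b = (\<lambda>i. (f ^^ i) a)"
  have b_per: "(f ^^ p) (b i) = b i" for i
    unfolding b_def by (metis add.commute comp_apply funpow_add per(1))
  have b_Suc: "f (b i) = b (Suc i)" for i by (simp add: b_def)
  have b_stable: "b i \<in> stable_set f" for i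
  proof (induction i)
    case 0
    then show ?case using periodic_point_stable[OF brj f(1) per(1,2,5)] by (simp add: b_def)
  next
    case (Suc i)
    then show ?case using stable_set_image[OF f] b_Suc[of i] by auto
  qed
  note hol = holomorphic_funpow[OF f(1)]
  \<comment> \<open>The chain rule is applied to the iterate of order \<open>p + i\<close> in both
    orders. The common factor can be cancelled because it divides the multiplier at
    \<open>a\<close>, which is not \<open>0\<close>.\<close>
  have b_deriv: "deriv (f ^^ p) (b i) = \<rho>" if "i < p" for i
  proof -
    have d: "((f ^^ n) has_field_derivative deriv (f ^^ n) z) (at z)" for n z
      using holomorphic_derivI[OF hol open_UNIV] by simp
    have 1: "deriv (f ^^ (m + n)) z = deriv (f ^^ m) ((f ^^ n) z) * deriv (f ^^ n) z" for m n z
      unfolding funpow_add by (rule DERIV_imp_deriv[OF DERIV_chain[OF d d]])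
    have "deriv (f ^^ p) (b i) * deriv (f ^^ i) a = deriv (f ^^ i) a * \<rho>"
      using 1[of p i a] 1[of i p a] per(1,5) unfolding b_def \<rho>_def by (metis add.commute)
    moreover have "deriv (f ^^ i) a \<noteq> 0"
      using 1[of "p - i" i a] that per(5) by auto
    ultimately show ?thesis by (metis mult.commute mult_right_cancel)
  qed
  define U where "U = (\<lambda>i. connected_component_set (fatou_set f) (b i))"
  have b_fatou: "b i \<in> fatou_set f" for i
    using b_stable stable_set_subset_fatou_set[OF f(1)] by blast
  have U: "U i \<in> components (fatou_set f)" "b i \<in> U i" for i
    using b_fatou[of i] by (auto simp: U_def components_def)
  have U_stable: "U i \<subseteq> stable_set f" for i
    using fatou_component_subset_stable_set[OF U b_stable] .
  have U_image: "(f ^^ n) ` U i \<subseteq> U (i + n)" for n i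
  proof (induction n)
    case (Suc n)
    have "f ` U (i + n) \<subseteq> U (Suc (i + n))"
    proof -
      have "f ` U (i + n) \<subseteq> stable_set f" using stable_set_image[OF f] U_stable by blast
      then have "f ` U (i + n) \<subseteq> fatou_set f" using stable_set_subset_fatou_set[OF f(1)] by blast
      moreover have "connected (f ` U (i + n))"
        using holomorphic_on_imp_continuous_on[OF f(1)] in_components_connected[OF U(1)]
        by (intro connected_continuous_image) (auto elim: continuous_on_subset)
      moreover have "b (Suc (i + n)) \<in> f ` U (i + n)" using U(2)[of "i + n"] b_Suc[of "i + n"] by force
      ultimately show ?thesis using U[of "Suc (i + n)"] components_maximal by (metis disjoint_iff)
    qed
    then show ?case using Suc by auto
  qed simp
  have bp: "b (i + p) = b i" for i using per(1) unfolding b_def by (simp add: funpow_add)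
  then have Up: "U (i + p) = U i" for i by (simp add: U_def)
  have sc: "simply_connected (U i)" for i
    by (rule simply_connected_stable_component[OF f(1) U(1) U_stable])
  have rot: "conj_to_rotation (f ^^ p) (U i) \<theta>" if "i < p" for i
  proof (rule conj_to_rotation_fixed_point)
    show "(f ^^ p) holomorphic_on U i" using hol holomorphic_on_subset by blast
    show "(f ^^ p) ` U i \<subseteq> U i" using U_image[of p i] Up by simp
    show "open (U i)" using U(1) open_fatou_set open_components by blast
    show "U i \<noteq> UNIV" using stable_set_neq_UNIV[OF f(1) r per(1-3)] U_stable by blast
    show "deriv (f ^^ p) (b i) = exp (2 * complex_of_real pi * \<i> * complex_of_real \<theta>)"
      using b_deriv[OF that] by (simp add: \<rho>_def)
  qed (use sc U b_per in auto)
  have "inj_on U {..<p}"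
  proof (rule inj_onI)
    fix i j assume ij: "i \<in> {..<p}" "j \<in> {..<p}" "U i = U j"
    obtain \<phi> where \<phi>: "conformal_iso \<phi> (U i) (ball 0 1)" "\<And>z. z \<in> U i \<Longrightarrow> \<phi> ((f ^^ p) z) = \<rho> * \<phi> z"
      using rot[of i] ij unfolding conj_to_rotation_def \<rho>_def by auto
    have "\<phi> (b k) = 0" if "b k \<in> U i" for k
      using \<phi>(2)[OF that] b_per[of k] \<rho>1 by (metis mult_cancel_right1)
    then have "\<phi> (b i) = \<phi> (b j)" using U(2) ij(3) by metis
    moreover have "inj_on \<phi> (U i)" using \<phi>(1) unfolding conformal_iso_def bij_betw_def by blast
    ultimately have "b i = b j" using U(2) ij(3) by (metis inj_onD)
    then show "i = j" using per(4) ij unfolding b_def by (simp add: inj_on_def)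
  qed
  moreover have "f ` U i \<subseteq> U (Suc i mod p)" if "i < p" for i
  proof (cases "Suc i = p")
    case True
    then show ?thesis using U_image[of 1 i] Up[of 0] by simp
  next
    case False
    then show ?thesis using U_image[of 1 i] that by simp
  qed
  ultimately have "siegel_cycle f p \<theta> U"
    unfolding siegel_cycle_def using U(1) sc rot by blast
  then show ?thesis by blast
qed

section \<open>Cycles with prescribed multiplier\<close>

lemma holomorphic_E: "E lam holomorphic_on UNIV"
  unfolding E_def[abs_def] by (auto intro!: holomorphic_intros)

lemma E_exp: "E (exp l) (exp v) = exp (l + 2 * v + exp v)"
  unfolding E_def mult_2 exp_add power2_eq_square by (simp only: mult_ac)

lemma E_orbit_nonzero: "lam \<noteq> 0 \<Longrightarrow> z \<noteq> 0 \<Longrightarrow> (E lam ^^ n) z \<noteq> 0"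
  by (induction n) (auto simp: E_def)

text \<open>The logarithmic derivative of \<open>E\<close> with respect to \<open>ln z\<close> is
  \<open>2 + z\<close>, and the quotients of successive orbit points telescope. On a cycle the
  leading quotient is \<open>1\<close>.\<close>

lemma deriv_E_iterate:
  assumes "lam \<noteq> 0" "z \<noteq> 0"
  shows "deriv (E lam ^^ n) z = (E lam ^^ n) z / z * (\<Prod>i<n. 2 + (E lam ^^ i) z)"
proof -
  have E': "(E lam has_field_derivative (E lam w / w * (2 + w))) (at w)" if "w \<noteq> 0" for w
    unfolding E_def[abs_def] using that
    by (auto intro!: derivative_eq_intros simp: field_simps power2_eq_square)
  have "((E lam ^^ n) has_field_derivative ((E lam ^^ n) z / z * (\<Prod>i<n. 2 + (E lam ^^ i) z))) (at z)"
  proof (induction n)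
    case 0
    have "((\<lambda>w. w) has_field_derivative 1) (at z)" by simp
    then show ?case using assms by (simp add: id_def)
  next
    case (Suc n)
    have "(E lam \<circ> (E lam ^^ n) has_field_derivative
        E lam ((E lam ^^ n) z) / (E lam ^^ n) z * (2 + (E lam ^^ n) z) *
        ((E lam ^^ n) z / z * (\<Prod>i<n. 2 + (E lam ^^ i) z))) (at z)"
      by (intro DERIV_chain E' Suc E_orbit_nonzero assms)
    then show ?case using E_orbit_nonzero[OF assms, of n] by (simp add: o_def mult_ac)
  qed
  then show ?thesis by (rule DERIV_imp_deriv)
qed

text \<open>Taking a square root in \<open>lam * z^2 * exp z = y\<close> leads to
  \<open>z * exp (z / 2) = s\<close> with \<open>s^2 = y / lam\<close>. The left side has derivative
  \<open>1\<close> at \<open>0\<close>, hence a local inverse.\<close>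

lemma local_inverse_times_exp:
  obtains \<psi> :: "complex \<Rightarrow> complex" and \<delta> :: real where "\<delta> > 0" "continuous_on (ball 0 \<delta>) \<psi>"
    "\<And>s. s \<in> ball 0 \<delta> \<Longrightarrow> \<psi> s * exp (\<psi> s / 2) = s" "\<And>s. s \<in> ball 0 \<delta> \<Longrightarrow> norm (\<psi> s) \<le> 1 / 2"
proof -
  define f where "f = (\<lambda>z::complex. z * exp (z / 2))"
  have f: "f holomorphic_on A" for A unfolding f_def by (auto intro!: holomorphic_intros)
  have "(f has_field_derivative 1) (at 0)" unfolding f_def
    by (auto intro!: derivative_eq_intros)
  then have df: "deriv f 0 \<noteq> 0" using DERIV_imp_deriv by fastforce
  obtain r where r: "r > 0" "ball 0 r \<subseteq> ball (0::complex) (1 / 2)" "open (f ` ball 0 r)" "inj_on f (ball 0 r)"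
  proof (rule has_complex_derivative_locally_invertible[OF f[of "ball 0 (1 / 2)"] _ open_ball df])
    show "(0::complex) \<in> ball 0 (1 / 2)" by simp
  qed (rule that)
  obtain \<psi> where \<psi>: "\<psi> holomorphic_on f ` ball 0 r" "\<And>z. z \<in> ball 0 r \<Longrightarrow> \<psi> (f z) = z"
    using holomorphic_has_inverse[OF f open_ball r(4)] by metis
  have "(0::complex) \<in> f ` ball 0 r" using r(1) by (intro image_eqI[of _ _ 0]) (auto simp: f_def)
  then obtain \<delta> where \<delta>: "\<delta> > 0" "ball (0::complex) \<delta> \<subseteq> f ` ball 0 r"
    using r(3) open_contains_ball by blast
  show thesis
  proof (rule that[OF \<delta>(1)])
    show "continuous_on (ball 0 \<delta>) \<psi>"
      by (rule continuous_on_subset[OF holomorphic_on_imp_continuous_on[OF \<psi>(1)] \<delta>(2)])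
    fix s :: complex assume "s \<in> ball 0 \<delta>"
    then obtain z where z: "z \<in> ball 0 r" "s = f z" using \<delta>(2) by blast
    then show "\<psi> s * exp (\<psi> s / 2) = s" by (simp add: \<psi>(2) f_def[symmetric]) (simp add: f_def)
    show "norm (\<psi> s) \<le> 1 / 2" using z r(2) by (auto simp: \<psi>(2))
  qed
qed

text \<open>For \<open>\<psi>\<close> the local inverse of \<open>z \<mapsto> z * exp (z / 2)\<close>, this is the inverse branch near \<open>0\<close> of
  \<open>E (exp l)\<close>, written in the coordinate \<open>w = ln z\<close>, in which no square root has to be chosen.\<close>

definition inv_branch :: "(complex \<Rightarrow> complex) \<Rightarrow> complex \<Rightarrow> complex \<Rightarrow> complex" where
  "inv_branch \<psi> l w = (w - l) / 2 - \<psi> (exp ((w - l) / 2)) / 2"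

section \<open>Construction of the cycle by Brouwer's theorem\<close>

lemma norm_Ln_le:
  assumes "z \<noteq> 0"
  shows "norm (Ln z) \<le> \<bar>ln (norm z)\<bar> + pi"
proof -
  have "norm (Ln z) \<le> \<bar>Re (Ln z)\<bar> + \<bar>Im (Ln z)\<bar>" by (rule cmod_le)
  also have "\<bar>Im (Ln z)\<bar> \<le> pi" using mpi_less_Im_Ln[OF assms] Im_Ln_le_pi[OF assms] by auto
  finally show ?thesis using assms by simp
qed

text \<open>The unknowns are \<open>u = a + 2\<close> and the huge point \<open>y\<close>, the image
  of \<open>a\<close>. The parameter is chosen to send \<open>a\<close> to \<open>y\<close>, and the
  remaining points are obtained by pulling \<open>a\<close> back along the inverse branch near
  \<open>0\<close>. Two equations are left: the multiplier is \<rho>, and \<open>y\<close> is sent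
  to the earliest of the points pulled back.\<close>

lemma exists_cycle_with_multiplier:
  fixes \<rho> :: complex
  assumes \<rho>: "norm \<rho> = 1" and p: "p \<ge> 2"
  obtains lam a where "lam \<noteq> 0" "a \<noteq> 0" "(E lam ^^ p) a = a" "inj_on (\<lambda>i. (E lam ^^ i) a) {..<p}"
    "deriv (E lam ^^ p) a = \<rho>"
proof -
  obtain \<psi> :: "complex \<Rightarrow> complex" and \<delta> :: real where \<delta>: "\<delta> > 0" and \<psi>_cont: "continuous_on (ball 0 \<delta>) \<psi>"
    and \<psi>_inv: "\<And>s. s \<in> ball 0 \<delta> \<Longrightarrow> \<psi> s * exp (\<psi> s / 2) = s"
    and \<psi>_le: "\<And>s. s \<in> ball 0 \<delta> \<Longrightarrow> norm (\<psi> s) \<le> 1 / 2"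
    by (rule local_inverse_times_exp) (rule that)
  let ?B = "inv_branch \<psi>"
  \<comment> \<open>For \<open>Re w \<le> 2\<close> and \<open>Re l \<ge> R\<close> the real part of
    \<open>(w - l) / 2\<close> is at most \<open>ln \<delta> - 1 / 2\<close>, which brings its
    exponential into the domain of \<psi>.\<close>
  define R where "R = 3 - 2 * ln \<delta>"
  have small: "exp ((w - l) / 2) \<in> ball 0 \<delta>" if "Re w \<le> 2" "R \<le> Re l" for w l
  proof -
    have "Re ((w - l) / 2) < ln \<delta>" using that by (simp add: R_def)
    then have "exp (Re ((w - l) / 2)) < \<delta>" using \<delta> by (metis exp_less_cancel_iff exp_ln)
    then show ?thesis by (simp add: norm_exp_eq_Re)
  qed
  have B_exp: "exp (?B l w) = \<psi> (exp ((w - l) / 2))" if "Re w \<le> 2" "R \<le> Re l" for w l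
  proof -
    define s where "s = exp ((w - l) / 2)"
    have "exp (?B l w) = s / exp (\<psi> s / 2)" by (simp add: inv_branch_def s_def exp_diff)
    also have "\<dots> = \<psi> s" using \<psi>_inv[OF small[OF that], folded s_def] by (simp add: field_simps)
    finally show ?thesis by (simp add: s_def)
  qed
  have B_E: "E (exp l) (exp (?B l w)) = exp w" if "Re w \<le> 2" "R \<le> Re l" for w l
    unfolding E_exp using B_exp[OF that] by (simp add: inv_branch_def field_simps)
  have B_half: "norm (exp (?B l w)) \<le> 1 / 2" if "Re w \<le> 2" "R \<le> Re l" for w l
    unfolding B_exp[OF that] by (rule \<psi>_le[OF small[OF that]])
  have B_Re: "Re (?B l w) \<le> 2" if "Re w \<le> 2" "R \<le> Re l" for w l
  proof -
    have "exp (Re (?B l w)) \<le> 1 / 2" using B_half[OF that] by (simp only: norm_exp_eq_Re)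
    also have "\<dots> \<le> exp 2" using exp_ge_add_one_self[of "2 :: real"] by linarith
    finally show ?thesis by simp
  qed
  \<comment> \<open>The inverse branch halves \<open>w - l\<close>, so a bound of the form
    \<open>norm l + 10\<close> reproduces itself. The estimates along the backward orbit therefore
    do not depend on its length.\<close>
  have B_norm: "norm (?B l w) \<le> norm l + 10" if "Re w \<le> 2" "R \<le> Re l" "norm w \<le> norm l + 10" for w l
  proof -
    define t where "t = \<psi> (exp ((w - l) / 2))"
    have "norm (?B l w) \<le> norm ((w - l) / 2) + norm (t / 2)"
      unfolding inv_branch_def t_def by (rule norm_triangle_ineq4)
    also have "\<dots> = norm (w - l) / 2 + norm t / 2" by (simp add: norm_divide)
    finally show ?thesis
      using \<psi>_le[OF small[OF that(1,2)], folded t_def] norm_triangle_ineq4[of w l] that(3) by linarith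
  qed
  have "\<forall>\<^sub>F m::nat in sequentially. 4 * ln (8 * real m) + 100 \<le> real m" by real_asymp
  moreover have "\<forall>\<^sub>F m::nat in sequentially. R + 3 \<le> ln (real m)" by real_asymp
  moreover have "\<forall>\<^sub>F m::nat in sequentially. 2 \<le> m" by (rule eventually_ge_at_top)
  ultimately have "\<forall>\<^sub>F m::nat in sequentially.
      4 * ln (8 * real m) + 100 \<le> real m \<and> R + 3 \<le> ln (real m) \<and> 2 \<le> m"
    by (intro eventually_conj)
  \<comment> \<open>The first inequality keeps the second component of \<open>T\<close> within
    distance \<open>m\<close> of \<open>c\<close>; the second one keeps \<open>Re l\<close> at least
    \<open>R\<close>, as needed for the inverse branches.\<close>
  then obtain m :: nat where m: "4 * ln (8 * real m) + 100 \<le> real m" "R + 3 \<le> ln (real m)" "2 \<le> m"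
    unfolding eventually_sequentially by blast
  \<comment> \<open>Since \<open>exp c = 1\<close>, adding \<open>c\<close> only selects a
    logarithm, the one for which \<open>y\<close> is huge. On the disk of radius \<open>m\<close>
    about \<open>c\<close> the imaginary part is positive, so \<open>Ln\<close> is continuous
    there.\<close>
  define c where "c = complex_of_real (2 * pi * m) * \<i>"
  define S where "S = cball (0::complex) (1 / 2) \<times> cball c (real m)"
  \<comment> \<open>\<open>w\<close> is a continuous logarithm of \<open>a = u - 2\<close>, taken
    through \<open>2 - u\<close> in the right half-plane; \<open>l\<close> is a logarithm of the
    parameter \<open>y / (a^2 * exp a)\<close>. \<open>W k\<close> is the logarithm of the point
    \<open>k\<close> steps before the return to \<open>a\<close>.\<close>
  define w where "w = (\<lambda>x::complex \<times> complex. Ln (2 - fst x) + \<i> * of_real pi)"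
  define l where "l = (\<lambda>x::complex \<times> complex. Ln (snd x) - 2 * w x - (fst x - 2))"
  define W where "W = (\<lambda>k x. (?B (l x) ^^ k) (w x))"
  define P where "P = (\<lambda>x. (2 + snd x) * (\<Prod>i=2..<p. 2 + exp (W (p - i) x)))"
  \<comment> \<open>\<open>P\<close> is the product of \<open>2 + z\<close> over all orbit points
    except \<open>a\<close>, so a fixed first component says \<open>(2 + a) * P = \<rho>\<close>. A
    fixed second component says \<open>l + 2 * Ln y + y = W (p - 2) + c\<close>, whose exponential
    says that \<open>E\<close> sends \<open>y\<close> to the next point.\<close>
  define T where "T = (\<lambda>x. (\<rho> / P x, W (p - 2) x - l x - 2 * Ln (snd x) + c))"
  have S_fst: "norm u \<le> 1 / 2" "Re (2 - u) > 0" "norm (2 - u) \<le> 5 / 2" "norm (2 - u) \<ge> 3 / 2"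
    if "(u, y) \<in> S" for u y
  proof -
    show u: "norm u \<le> 1 / 2" using that by (simp add: S_def)
    show "Re (2 - u) > 0" using u abs_Re_le_cmod[of u] by simp
    show "norm (2 - u) \<le> 5 / 2" using u norm_triangle_ineq4[of 2 u] by simp
    show "norm (2 - u) \<ge> 3 / 2" using u norm_triangle_ineq2[of 2 u] by simp
  qed
  have S_snd: "5 * real m \<le> norm y" "norm y \<le> 8 * real m" "Im y > 0" if "(u, y) \<in> S" for u y
  proof -
    have d: "norm (c - y) \<le> real m" using that by (simp add: S_def dist_norm)
    have c: "norm c = 2 * pi * m" by (simp add: c_def norm_mult)
    have pi: "6 * real m \<le> 2 * pi * m" "2 * pi * m \<le> 7 * real m"
      using pi_approx by (intro mult_right_mono; simp)+
    show "5 * real m \<le> norm y" using d c pi norm_triangle_ineq2[of c "c - y"] by simp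
    show "norm y \<le> 8 * real m" using d c pi norm_triangle_ineq4[of c "c - y"] by simp
    have "Im (c - y) \<le> real m" using d abs_Im_le_cmod[of "c - y"] by simp
    then have "2 * pi * m - Im y \<le> real m" by (simp add: c_def)
    then show "Im y > 0" using pi(1) m(3) by linarith
  qed
  have w_exp: "exp (w x) = fst x - 2" if "x \<in> S" for x
  proof -
    have "norm (2 - fst x) \<ge> 3 / 2" using S_fst(4)[of "fst x" "snd x"] that by simp
    then have "2 - fst x \<noteq> 0" by auto
    then show ?thesis by (simp add: w_def exp_add)
  qed
  have l_exp: "exp (l x) * (fst x - 2)\<^sup>2 * exp (fst x - 2) = snd x" if "x \<in> S" for x
  proof -
    have nz: "snd x \<noteq> 0" using S_snd(3)[of "fst x" "snd x"] that by auto
    have nz': "fst x - 2 \<noteq> 0" using w_exp[OF that] by (metis exp_not_eq_zero)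
    have "exp (2 * w x) = (fst x - 2)\<^sup>2" using w_exp[OF that] by (simp add: exp_double)
    then show ?thesis using nz nz' by (simp add: l_def exp_diff exp_Ln)
  qed
  have Ln2u: "norm (Ln (2 - fst x)) \<le> 3 / 2 + pi" "Re (Ln (2 - fst x)) \<le> 3 / 2" if "x \<in> S" for x
  proof -
    let ?a = "norm (2 - fst x)"
    have a: "3 / 2 \<le> ?a" "?a \<le> 5 / 2" using S_fst[of "fst x" "snd x"] that by auto
    then have nz: "2 - fst x \<noteq> 0" by auto
    have "ln ?a \<le> ?a - 1" using a by (intro ln_le_minus_one) linarith
    moreover have "ln ?a \<ge> 0" using a by simp
    ultimately have "\<bar>ln ?a\<bar> \<le> 3 / 2" using a by linarith
    then show "norm (Ln (2 - fst x)) \<le> 3 / 2 + pi" "Re (Ln (2 - fst x)) \<le> 3 / 2"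
      using norm_Ln_le[OF nz] nz by auto
  qed
  have pi4: "pi < 4" by (rule pi_less_4)
  have pi3: "pi < 3.2" using pi_approx by simp
  have w_norm: "norm (w x) \<le> 10" if "x \<in> S" for x
    using norm_triangle_ineq[of "Ln (2 - fst x)" "\<i> * of_real pi"] Ln2u(1)[OF that] pi3
    by (simp add: w_def norm_mult)
  have w_Re: "Re (w x) \<le> 2" "Re (w x) \<le> 3 / 2" if "x \<in> S" for x
    using Ln2u(2)[OF that] by (simp_all add: w_def)
  have Ln_y: "norm (Ln (snd x)) \<le> ln (8 * real m) + 4" "ln (real m) \<le> Re (Ln (snd x))" if "x \<in> S" for x
  proof -
    let ?a = "norm (snd x)"
    have a: "5 * real m \<le> ?a" "?a \<le> 8 * real m" using S_snd[of "fst x" "snd x"] that by auto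
    have "?a > 0" using a m(3) by linarith
    then have nz: "snd x \<noteq> 0" by auto
    have "ln ?a \<le> ln (8 * real m)" "ln (real m) \<le> ln ?a"
      using a m(3) \<open>?a > 0\<close> by (auto intro!: ln_mono)
    moreover have "0 \<le> ln (real m)" using m(3) by simp
    ultimately have "\<bar>ln ?a\<bar> \<le> ln (8 * real m)" "ln (real m) \<le> ln ?a" by auto
    then show "norm (Ln (snd x)) \<le> ln (8 * real m) + 4" "ln (real m) \<le> Re (Ln (snd x))"
      using norm_Ln_le[OF nz] nz pi4 by auto
  qed
  have l_norm: "norm (l x) \<le> ln (8 * real m) + 27" if "x \<in> S" for x
  proof -
    have "norm (fst x - 2) \<le> 3" using S_fst(3)[of "fst x" "snd x"] that by (simp add: norm_minus_commute)
    moreover have "norm (l x) \<le> norm (Ln (snd x)) + 2 * norm (w x) + norm (fst x - 2)"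
      unfolding l_def using norm_triangle_ineq4[of "Ln (snd x) - 2 * w x" "fst x - 2"]
        norm_triangle_ineq4[of "Ln (snd x)" "2 * w x"] by (simp add: norm_mult)
    ultimately show ?thesis using w_norm[OF that] Ln_y(1)[OF that] by linarith
  qed
  have l_Re: "R \<le> Re (l x)" if "x \<in> S" for x
    using Ln_y(2)[OF that] w_Re(2)[OF that] m(2) S_fst(2)[of "fst x" "snd x"] that
    by (simp add: l_def)
  have W_bounds: "Re (W k x) \<le> 2 \<and> norm (W k x) \<le> norm (l x) + 10" if "x \<in> S" for k x
  proof (induction k)
    case 0
    then show ?case using w_Re[OF that] w_norm[OF that] norm_ge_zero[of "l x"]
      by (simp add: W_def del: norm_ge_zero)
  next
    case (Suc k)
    then show ?case using B_Re[OF _ l_Re[OF that]] B_norm[OF _ l_Re[OF that]] by (simp add: W_def)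
  qed
  have W_E: "E (exp (l x)) (exp (W (Suc k) x)) = exp (W k x)" if "x \<in> S" for k x
    using B_E[OF _ l_Re[OF that]] W_bounds[OF that, of k] by (simp add: W_def)
  have W_half: "norm (exp (W k x)) \<le> 1 / 2" if "x \<in> S" "k > 0" for k x
    using B_half[OF _ l_Re[OF that(1)]] W_bounds[OF that(1), of "k - 1"] that(2)
    by (cases k) (simp_all add: W_def)
  have w_cont: "continuous_on S w"
  proof -
    have "2 - fst x \<notin> \<real>\<^sub>\<le>\<^sub>0" if "x \<in> S" for x
      using S_fst(2)[of "fst x" "snd x"] that by (auto simp: complex_nonpos_Reals_iff)
    then show ?thesis unfolding w_def by (intro continuous_intros) auto
  qed
  have Ln_cont: "continuous_on S (\<lambda>x. Ln (snd x))"
  proof -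
    have "snd x \<notin> \<real>\<^sub>\<le>\<^sub>0" if "x \<in> S" for x
      using S_snd(3)[of "fst x" "snd x"] that by (auto simp: complex_nonpos_Reals_iff)
    then show ?thesis by (intro continuous_intros) auto
  qed
  have l_cont: "continuous_on S l"
    unfolding l_def by (intro continuous_intros w_cont Ln_cont)
  have W_cont: "continuous_on S (W k)" for k
  proof (induction k)
    case 0
    then show ?case using w_cont by (simp add: W_def)
  next
    case (Suc k)
    have "continuous_on S (\<lambda>x. \<psi> (exp ((W k x - l x) / 2)))"
    proof (rule continuous_on_compose2[OF \<psi>_cont])
      show "continuous_on S (\<lambda>x. exp ((W k x - l x) / 2))"
        by (intro continuous_intros Suc l_cont) auto
      show "(\<lambda>x. exp ((W k x - l x) / 2)) ` S \<subseteq> ball 0 \<delta>"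
        using small W_bounds l_Re by blast
    qed
    then have "continuous_on S (\<lambda>x. (W k x - l x) / 2 - \<psi> (exp ((W k x - l x) / 2)) / 2)"
      by (intro continuous_intros Suc l_cont) auto
    then show ?case by (simp add: W_def inv_branch_def)
  qed
  \<comment> \<open>The points close to \<open>0\<close> give factors of modulus at least
    \<open>1\<close>, and the huge point one of modulus at least \<open>2\<close>. Hence
    \<open>\<rho> / P x\<close> stays in the disk of radius \<open>1 / 2\<close>.\<close>
  have P_ge: "norm (P x) \<ge> 2" if "x \<in> S" for x
  proof -
    have "norm (2 + exp (W (p - i) x)) \<ge> 1" if "i \<in> {2..<p}" for i
      using W_half[OF \<open>x \<in> S\<close>, of "p - i"] that norm_triangle_ineq2[of 2 "- exp (W (p - i) x)"] by simp
    then have 1: "(\<Prod>i=2..<p. norm (2 + exp (W (p - i) x))) \<ge> 1" by (intro prod_ge_1) auto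
    have "norm (2 + snd x) \<ge> 2"
      using S_snd(1)[of "fst x" "snd x"] that m(3) norm_triangle_ineq2[of "snd x" "- 2"]
      by (simp add: add.commute)
    then have "2 * 1 \<le> norm (2 + snd x) * (\<Prod>i=2..<p. norm (2 + exp (W (p - i) x)))"
      using 1 by (intro mult_mono) auto
    then show ?thesis by (simp add: P_def norm_mult prod_norm)
  qed
  obtain x where x: "x \<in> S" "T x = x"
  proof (rule brouwer[of S T])
    show "compact S" "convex S" unfolding S_def
      by (auto intro: compact_Times convex_Times)
    show "S \<noteq> {}" by (auto simp: S_def)
    have "P x \<noteq> 0" if "x \<in> S" for x using P_ge[OF that] by auto
    then show "continuous_on S T"
      unfolding T_def P_def by (intro continuous_intros W_cont l_cont Ln_cont) (auto simp: P_def)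
    show "T \<in> S \<rightarrow> S"
    proof
      fix x assume x: "x \<in> S"
      have "norm (\<rho> / P x) \<le> 1 / 2"
        using \<rho> P_ge[OF x] by (simp add: norm_divide divide_le_eq)
      moreover have "norm (W (p - 2) x - l x - 2 * Ln (snd x)) \<le> real m"
      proof -
        have "norm (W (p - 2) x - l x - 2 * Ln (snd x))
            \<le> norm (W (p - 2) x) + norm (l x) + 2 * norm (Ln (snd x))"
          using norm_triangle_ineq4[of "W (p - 2) x - l x" "2 * Ln (snd x)"]
            norm_triangle_ineq4[of "W (p - 2) x" "l x"] by (simp add: norm_mult)
        then show ?thesis
          using W_bounds[OF x, of "p - 2"] l_norm[OF x] Ln_y(1)[OF x] m(1) by linarith
      qed
      moreover have "dist c (A + c) = norm A" for A by (simp add: dist_norm)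
      ultimately show "T x \<in> S" by (simp only: T_def S_def mem_Times_iff fst_conv snd_conv mem_cball dist_0_norm)
    qed
  qed
  define lam where "lam = exp (l x)"
  define a where "a = fst x - 2"
  define orb where "orb = (\<lambda>i. if i = 0 then a else if i = 1 then snd x else exp (W (p - i) x))"
  have lam0: "lam \<noteq> 0" by (simp add: lam_def)
  have a_norm: "3 / 2 \<le> norm a" "norm a \<le> 5 / 2"
    using S_fst[of "fst x" "snd x"] x(1) by (auto simp: a_def norm_minus_commute)
  have a0: "a \<noteq> 0" using a_norm by auto
  have fix1: "\<rho> / P x = fst x" and fix2: "W (p - 2) x - l x - 2 * Ln (snd x) + c = snd x"
    using x(2) by (auto simp: T_def prod_eq_iff)
  have orb_Suc: "E lam (orb i) = orb (Suc i)" if "i < p" for i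
  proof -
    consider "i = 0" | "i = 1" | "i \<ge> 2" by force
    then show ?thesis
    proof cases
      case 1
      then show ?thesis using l_exp[OF x(1)] by (simp add: orb_def E_def lam_def a_def)
    next
      case 2
      have nz: "snd x \<noteq> 0" using S_snd(3)[of "fst x" "snd x"] x(1) by auto
      have "W (p - 2) x = l x + 2 * Ln (snd x) + snd x - c" using fix2 by (simp add: algebra_simps)
      then have "exp (W (p - 2) x) = exp (l x + 2 * Ln (snd x) + snd x) / exp c"
        by (simp add: exp_diff)
      also have "exp c = 1" unfolding c_def using exp_two_pi_i exp_of_nat_mult[of m "2 * of_real pi * \<i>"]
        by (simp add: mult_ac)
      also have "exp (l x + 2 * Ln (snd x) + snd x) = E lam (exp (Ln (snd x)))"
        unfolding lam_def E_exp using nz by simp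
      finally show ?thesis using 2 nz by (simp add: orb_def numeral_2_eq_2)
    next
      case 3
      then show ?thesis using W_E[OF x(1), of "p - Suc i"] that by (simp add: orb_def lam_def Suc_diff_Suc)
    qed
  qed
  have orb: "(E lam ^^ i) a = orb i" if "i \<le> p" for i
    using that
  proof (induction i)
    case 0
    then show ?case by (simp add: orb_def)
  next
    case (Suc i)
    then show ?case using orb_Suc[of i] by simp
  qed
  have orb_p: "orb p = a"
    using p w_exp[OF x(1)] by (simp add: orb_def W_def a_def)
  \<comment> \<open>The moduli separate the points: \<open>a\<close> lies between
    \<open>3 / 2\<close> and \<open>5 / 2\<close>, the next point is at least \<open>5 * m\<close>,
    and the others are at most \<open>1 / 2\<close>.\<close>
  have orb_neq: "orb i \<noteq> a" if "0 < i" "i < p" for i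
  proof (cases "i = 1")
    case True
    then show ?thesis using a_norm m(3) S_snd(1)[of "fst x" "snd x"] x(1) by (auto simp: orb_def)
  next
    case False
    then have "norm (orb i) \<le> 1 / 2" using W_half[OF x(1), of "p - i"] that by (simp add: orb_def)
    then show ?thesis using a_norm by auto
  qed
  \<comment> \<open>Applying \<open>p - j\<close> further iterations to a coincidence would bring
    the orbit back to \<open>a\<close> before time \<open>p\<close>.\<close>
  have inj_aux: "orb i \<noteq> orb j" if "i < j" "j < p" for i j
  proof
    assume eq: "orb i = orb j"
    have "orb (p - j + i) = (E lam ^^ (p - j + i)) a"
      using orb[of "p - j + i"] that by simp
    also have "\<dots> = (E lam ^^ (p - j)) ((E lam ^^ i) a)" by (simp only: funpow_add comp_apply)
    also have "\<dots> = (E lam ^^ (p - j)) ((E lam ^^ j) a)" using orb[of i] orb[of j] eq that by simp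
    also have "\<dots> = (E lam ^^ (p - j + j)) a" by (simp only: funpow_add comp_apply)
    also have "\<dots> = a" using orb[of p] orb_p that by simp
    finally have "orb (p - j + i) = a" .
    moreover have "0 < p - j + i" "p - j + i < p" using that by arith+
    then have "orb (p - j + i) \<noteq> a" by (rule orb_neq)
    ultimately show False by contradiction
  qed
  show thesis
  proof (rule that[OF lam0 a0])
    show "(E lam ^^ p) a = a" using orb[of p] orb_p by simp
    show "inj_on (\<lambda>i. (E lam ^^ i) a) {..<p}"
    proof (rule inj_onI)
      fix i j assume ij: "i \<in> {..<p}" "j \<in> {..<p}" "(E lam ^^ i) a = (E lam ^^ j) a"
      then have "orb i = orb j" using orb[of i] orb[of j] by simp
      then show "i = j" using inj_aux[of i j] inj_aux[of j i] ij by (metis lessThan_iff linorder_neqE_nat)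
    qed
    have "deriv (E lam ^^ p) a = (\<Prod>i<p. 2 + (E lam ^^ i) a)"
      using deriv_E_iterate[OF lam0 a0, of p] orb[of p] orb_p a0 by simp
    also have "\<dots> = (\<Prod>i<p. 2 + orb i)" using orb by (intro prod.cong) auto
    also have "{..<p} = insert 0 (insert 1 {2..<p})" using p by auto
    also have "(\<Prod>i\<in>insert 0 (insert 1 {2..<p}). 2 + orb i) = (2 + a) * P x"
      by (simp add: orb_def P_def)
    also have "\<dots> = (\<rho> / P x) * P x" by (simp add: a_def fix1)
    also have "\<dots> = \<rho>"
    proof -
      have "P x \<noteq> 0" using P_ge[OF x(1)] by auto
      then show ?thesis by simp
    qed
    finally show "deriv (E lam ^^ p) a = \<rho>" .
  qed
qed

theorem proposition3p3:
  fixes \<theta> :: real and p :: nat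
  assumes "brjuno \<theta>" and "p \<ge> 1"
  shows "\<exists>lam::complex. lam \<noteq> 0 \<and> (\<exists>U. siegel_cycle (E lam) p \<theta> U)"
proof -
  define \<rho> where "\<rho> = exp (2 * complex_of_real pi * \<i> * complex_of_real \<theta>)"
  have \<rho>: "norm \<rho> = 1" by (simp add: \<rho>_def norm_exp_eq_Re)
  obtain lam a where lam: "lam \<noteq> 0" and a: "a \<noteq> 0" "(E lam ^^ p) a = a"
    "inj_on (\<lambda>i. (E lam ^^ i) a) {..<p}" "deriv (E lam ^^ p) a = \<rho>"
  proof (cases "p = 1")
    case True
    \<comment> \<open>A fixed point other than \<open>0\<close> satisfies
      \<open>lam * a * exp a = 1\<close> and has multiplier \<open>2 + a\<close>, so the case
      \<open>p = 1\<close> is solved explicitly.\<close>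
    define a where "a = \<rho> - 2"
    have a0: "a \<noteq> 0" using \<rho> by (auto simp: a_def)
    define lam where "lam = 1 / (a * exp a)"
    have lam0: "lam \<noteq> 0" using a0 by (simp add: lam_def)
    have "E lam a = a" using a0 by (simp add: E_def lam_def power2_eq_square)
    moreover from this have "deriv (E lam) a = \<rho>"
      using deriv_E_iterate[OF lam0 a0, of 1] a0 by (simp add: a_def)
    ultimately show ?thesis using that[OF lam0 a0] True by (simp add: lessThan_Suc)
  next
    case False
    then have "2 \<le> p" using assms(2) by simp
    then show ?thesis by (rule exists_cycle_with_multiplier[OF \<rho>]) (rule that)
  qed
  \<comment> \<open>For \<open>norm z \<le> 1\<close> the exponential is at most
    \<open>exp 1\<close> in modulus; the second bound then makes the quadratic factor small enough
    for contraction by \<open>1 / 2\<close>.\<close>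
  define r where "r = min 1 (1 / (2 * norm lam * exp 1))"
  have r: "r > 0" using lam by (simp add: r_def)
  have contr: "norm (E lam z) \<le> norm z / 2" if "norm z < r" for z
  proof -
    have "norm (E lam z) = norm lam * norm z * norm z * norm (exp z)"
      by (simp add: E_def norm_mult norm_power power2_eq_square mult_ac)
    also have "\<dots> \<le> norm lam * norm z * (1 / (2 * norm lam * exp 1)) * exp 1"
    proof (intro mult_mono mult_nonneg_nonneg)
      have "Re z \<le> 1" using that complex_Re_le_cmod[of z] by (simp add: r_def)
      then show "norm (exp z) \<le> exp 1" by (simp add: norm_exp_eq_Re)
    qed (use that in \<open>auto simp: r_def\<close>)
    also have "\<dots> = norm z / 2" using lam by simp
    finally show ?thesis .
  qed
  have "\<not> E lam constant_on UNIV"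
  proof
    assume "E lam constant_on UNIV"
    then have "E lam 1 = E lam 0" unfolding constant_on_def by (metis UNIV_I)
    then show False using lam by (simp add: E_def)
  qed
  then have "\<exists>U. siegel_cycle (E lam) p \<theta> U"
    using siegel_cycle_exists[OF assms(1) holomorphic_E _ r contr a(2) assms(2) a(1,3)] a(4)
    by (simp add: \<rho>_def)
  then show ?thesis using lam by blast
qed

end
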